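(* There is an algorithm which, given a block graph $G=(V,E)$ with $n=|V|$ and $m=|E|$, computes a minimum ve-dominating set of $G$ (and hence $\gamma_{ve}(G)$) in $\mathcal{O}(n+m)$ time.
   Context: All graphs are finite, simple and undirected. For $u\in V$, $N_G[u]$ is the closed neighbourhood of $u$. A vertex $u$ ve-dominates an edge $e$ if $e$ is incident to some vertex of $N_G[u]$. A set $S\subseteq V$ is a ve-dominating set if every edge of $G$ is ve-dominated by some vertex of $S$; $\gamma_{ve}(G)$ is the minimum size of a ve-dominating set. A cut vertex is a vertex whose removal increases the number of connected components; a block is a maximal connected induced subgraph without a cut vertex of its own; $G$ is a block graph if every block of $G$ is a complete graph. *)

theory Defs
  imports Main
begin

section \<open>Graphs\<close>

text \<open>A graph is given by its vertex set \<open>V\<close> and its set \<open>E\<close> of two-element edges.\<close>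

definition simple_graph :: "'a set \<Rightarrow> 'a set set \<Rightarrow> bool" where
  "simple_graph V E \<longleftrightarrow> finite V \<and> (\<forall>e\<in>E. e \<subseteq> V \<and> card e = 2)"

definition closed_nbhd :: "'a set set \<Rightarrow> 'a \<Rightarrow> 'a set" where
  "closed_nbhd E u = insert u {v. {u, v} \<in> E}"

definition ve_dominates :: "'a set set \<Rightarrow> 'a \<Rightarrow> 'a set \<Rightarrow> bool" where
  "ve_dominates E u e \<longleftrightarrow> (\<exists>v \<in> closed_nbhd E u. v \<in> e)"

definition ve_dominating_set :: "'a set \<Rightarrow> 'a set set \<Rightarrow> 'a set \<Rightarrow> bool" where
  "ve_dominating_set V E S \<longleftrightarrow> S \<subseteq> V \<and> (\<forall>e\<in>E. \<exists>u\<in>S. ve_dominates E u e)"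

definition min_ve_dominating_set :: "'a set \<Rightarrow> 'a set set \<Rightarrow> 'a set \<Rightarrow> bool" where
  "min_ve_dominating_set V E S \<longleftrightarrow>
     ve_dominating_set V E S \<and> (\<forall>T. ve_dominating_set V E T \<longrightarrow> card S \<le> card T)"

definition gamma_ve :: "'a set \<Rightarrow> 'a set set \<Rightarrow> nat" where
  "gamma_ve V E = (LEAST k. \<exists>S. ve_dominating_set V E S \<and> card S = k)"

definition induced_edges :: "'a set set \<Rightarrow> 'a set \<Rightarrow> 'a set set" where
  "induced_edges E W = {e \<in> E. e \<subseteq> W}"

definition reachable :: "'a set set \<Rightarrow> 'a \<Rightarrow> 'a \<Rightarrow> bool" where
  "reachable E u v \<longleftrightarrow> (u, v) \<in> {(x, y). {x, y} \<in> E}\<^sup>*"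

definition components :: "'a set \<Rightarrow> 'a set set \<Rightarrow> 'a set set" where
  "components V E = (\<lambda>u. {v \<in> V. reachable E u v}) ` V"

definition connected_graph :: "'a set \<Rightarrow> 'a set set \<Rightarrow> bool" where
  "connected_graph V E \<longleftrightarrow> V \<noteq> {} \<and> (\<forall>u\<in>V. \<forall>v\<in>V. reachable E u v)"

definition cut_vertex :: "'a set \<Rightarrow> 'a set set \<Rightarrow> 'a \<Rightarrow> bool" where
  "cut_vertex V E v \<longleftrightarrow> v \<in> V \<and>
     card (components (V - {v}) (induced_edges E (V - {v}))) > card (components V E)"

definition connected_without_cut_vertex :: "'a set \<Rightarrow> 'a set set \<Rightarrow> bool" where
  "connected_without_cut_vertex V E \<longleftrightarrow> connected_graph V E \<and> (\<nexists>v. cut_vertex V E v)"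

text \<open>A block is an induced subgraph, so it is represented by its vertex set.\<close>

definition is_block :: "'a set \<Rightarrow> 'a set set \<Rightarrow> 'a set \<Rightarrow> bool" where
  "is_block V E B \<longleftrightarrow> B \<subseteq> V \<and> connected_without_cut_vertex B (induced_edges E B) \<and>
     (\<forall>C. B \<subset> C \<and> C \<subseteq> V \<longrightarrow> \<not> connected_without_cut_vertex C (induced_edges E C))"

definition complete_on :: "'a set set \<Rightarrow> 'a set \<Rightarrow> bool" where
  "complete_on E B \<longleftrightarrow> (\<forall>u\<in>B. \<forall>v\<in>B. u \<noteq> v \<longrightarrow> {u, v} \<in> E)"

definition block_graph :: "'a set \<Rightarrow> 'a set set \<Rightarrow> bool" where
  "block_graph V E \<longleftrightarrow> simple_graph V E \<and> (\<forall>B. is_block V E B \<longrightarrow> complete_on E B)"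


section \<open>Random-access programs and their running time\<close>

text \<open>
  The computation model is the random-access machine with words of logarithmic length, presented
  as a structured language. A state assigns a natural number to every entry of every named array;
  entry 0 of an array serves as a scalar variable. A program mentions only finitely many arrays,
  say \<open>K\<close> of them, so interleaving them (entry \<open>i\<close> of the \<open>j\<close>-th array in cell \<open>K * i + j\<close>) stores
  the state in one memory, at the price of constantly many additions per access.
\<close>

type_synonym state = "string \<Rightarrow> nat \<Rightarrow> nat"

datatype aexp = Const nat | Entry string aexp | Plus aexp aexp | Minus aexp aexp

datatype bexp = Less aexp aexp | Equal aexp aexp | Not bexp | And bexp bexp

datatype com =
    Skip
  | Assign string aexp aexp
  | Seq com com
  | If bexp com com
  | While bexp com

fun aval :: "aexp \<Rightarrow> state \<Rightarrow> nat" where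
  "aval (Const c) s = c"
| "aval (Entry x a) s = s x (aval a s)"
| "aval (Plus a b) s = aval a s + aval b s"
| "aval (Minus a b) s = aval a s - aval b s"

fun bval :: "bexp \<Rightarrow> state \<Rightarrow> bool" where
  "bval (Less a b) s \<longleftrightarrow> aval a s < aval b s"
| "bval (Equal a b) s \<longleftrightarrow> aval a s = aval b s"
| "bval (Not b) s \<longleftrightarrow> \<not> bval b s"
| "bval (And b c) s \<longleftrightarrow> bval b s \<and> bval c s"

text \<open>Every constant, memory access, arithmetic or logical operation and comparison costs one
  step.\<close>

fun acost :: "aexp \<Rightarrow> nat" where
  "acost (Const c) = 1"
| "acost (Entry x a) = acost a + 1"
| "acost (Plus a b) = acost a + acost b + 1"
| "acost (Minus a b) = acost a + acost b + 1"

fun bcost :: "bexp \<Rightarrow> nat" where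
  "bcost (Less a b) = acost a + acost b + 1"
| "bcost (Equal a b) = acost a + acost b + 1"
| "bcost (Not b) = bcost b + 1"
| "bcost (And b c) = bcost b + bcost c + 1"

text \<open>
  \<open>exec w c s t s'\<close>: the command \<open>c\<close>, started in \<open>s\<close>, terminates in \<open>s'\<close> after exactly \<open>t\<close> steps, and
  never stores a number exceeding \<open>w\<close>. If the initial entries are at most \<open>w\<close> as well, then all
  intermediate results and array indices are at most \<open>w\<close> times a constant depending only on \<open>c\<close>,
  since the depth of the expressions in \<open>c\<close> is fixed. So \<open>w\<close> bounds the word length, and long
  numbers cannot be used to do more than constant work in one step. A command that stores a larger
  number has no execution, just like one that does not terminate.
\<close>

inductive exec :: "nat \<Rightarrow> com \<Rightarrow> state \<Rightarrow> nat \<Rightarrow> state \<Rightarrow> bool" for w where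
  Skip: "exec w Skip s 1 s"
| Assign: "aval b s \<le> w \<Longrightarrow>
    exec w (Assign x a b) s (acost a + acost b + 1) (s(x := (s x)(aval a s := aval b s)))"
| Seq: "exec w c1 s1 t1 s2 \<Longrightarrow> exec w c2 s2 t2 s3 \<Longrightarrow> exec w (Seq c1 c2) s1 (t1 + t2) s3"
| IfTrue: "bval b s \<Longrightarrow> exec w c1 s t s' \<Longrightarrow> exec w (If b c1 c2) s (bcost b + t + 1) s'"
| IfFalse: "\<not> bval b s \<Longrightarrow> exec w c2 s t s' \<Longrightarrow> exec w (If b c1 c2) s (bcost b + t + 1) s'"
| WhileFalse: "\<not> bval b s \<Longrightarrow> exec w (While b c) s (bcost b + 1) s"
| WhileTrue: "bval b s1 \<Longrightarrow> exec w c s1 t1 s2 \<Longrightarrow> exec w (While b c) s2 t2 s3 \<Longrightarrow>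
    exec w (While b c) s1 (bcost b + t1 + t2 + 1) s3"

inductive_cases exec_SkipE: "exec w Skip s t s'"
inductive_cases exec_AssignE: "exec w (Assign x a b) s t s'"
inductive_cases exec_SeqE: "exec w (Seq c1 c2) s t s'"
inductive_cases exec_IfE: "exec w (If b c1 c2) s t s'"
inductive_cases exec_WhileE: "exec w (While b c) s t s'"

lemma exec_deterministic:
  "exec w c s t s' \<Longrightarrow> exec w c s u s'' \<Longrightarrow> u = t \<and> s'' = s'"
proof (induction arbitrary: u s'' rule: exec.induct)
  case (Skip s)
  then show ?case by (auto elim: exec_SkipE)
next
  case (Assign b s x a)
  then show ?case by (auto elim: exec_AssignE)
next
  case (Seq c1 s1 t1 s2 c2 t2 s3)
  from Seq.prems obtain u1 u2 r where "u = u1 + u2" "exec w c1 s1 u1 r" "exec w c2 r u2 s''"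
    by (rule exec_SeqE)
  with Seq.IH show ?case by metis
next
  case (IfTrue b s c1 t s' c2)
  from IfTrue.prems IfTrue.hyps obtain u' where "u = bcost b + u' + 1" "exec w c1 s u' s''"
    by (auto elim: exec_IfE)
  with IfTrue.IH show ?case by metis
next
  case (IfFalse b s c2 t s' c1)
  from IfFalse.prems IfFalse.hyps obtain u' where "u = bcost b + u' + 1" "exec w c2 s u' s''"
    by (auto elim: exec_IfE)
  with IfFalse.IH show ?case by metis
next
  case (WhileFalse b s c)
  from WhileFalse.prems show ?case
    by (rule exec_WhileE) (simp_all add: WhileFalse.hyps)
next
  case (WhileTrue b s1 c t1 s2 t2 s3)
  from WhileTrue.prems obtain u1 u2 r where
    "u = bcost b + u1 + u2 + 1" "exec w c s1 u1 r" "exec w (While b c) r u2 s''"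
    by (rule exec_WhileE) (simp_all add: WhileTrue.hyps)
  with WhileTrue.IH show ?case by metis
qed


section \<open>Input and output\<close>

text \<open>Adjacency lists of a graph on the vertices \<open>0, \<dots>, n - 1\<close>; each list may be in any order.\<close>

definition adjacency_lists :: "nat \<Rightarrow> nat set set \<Rightarrow> nat list list \<Rightarrow> bool" where
  "adjacency_lists n E adj \<longleftrightarrow> length adj = n \<and>
     (\<forall>v<n. distinct (adj ! v) \<and> set (adj ! v) = {u. {v, u} \<in> E})"

text \<open>The lists are stored one after the other in the array \<open>adj\<close>; the list of \<open>v\<close> occupies the
  entries from \<open>off[v]\<close> up to but excluding \<open>off[v + 1]\<close>. All other entries are 0.\<close>

definition input_state :: "nat list list \<Rightarrow> state" where
  "input_state adj = (\<lambda>x i.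
     if x = ''n'' \<and> i = 0 then length adj
     else if x = ''off'' \<and> i \<le> length adj then length (concat (take i adj))
     else if x = ''adj'' \<and> i < length (concat adj) then concat adj ! i
     else 0)"

definition output_list :: "state \<Rightarrow> nat list" where
  "output_list s = map (s ''out'') [0..<s ''size'' 0]"

end

theory Submission
  imports Defs
begin

text \<open>
  Number the vertices in breadth-first order. In a block graph every cycle spans a clique, and this
  forces every edge to join a vertex to its parent or to a child of its parent. Consequently every
  edge between \<open>x\<close> and \<open>y\<close>, where \<open>y\<close> is not the parent of \<open>x\<close>, has all its ve-dominators among the
  descendants of the parent of \<open>x\<close>. Running through the vertices \<open>x\<close> in reverse order, the greedy
  algorithm looks for such an edge that is not yet ve-dominated and, if there is one, selects the
  parent of \<open>x\<close> (a root is its own parent). The ve-dominators of the edges found in this way form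
  pairwise disjoint sets, and every ve-dominating set meets each of them; so no ve-dominating set is
  smaller than the greedy one.
\<close>

section \<open>Executions of programs\<close>

text \<open>Disjointness is where the reverse order counts. Let \<open>x' < x\<close> both lead to
  selections, \<open>x\<close> being treated first. The dominators of the edge at \<open>x\<close>
  lie below \<open>par x\<close>. Among those of the edge at \<open>x'\<close> is
  \<open>par x'\<close>, which is \<open>par x\<close> or lies outside that subtree; in the latter
  case a common dominator forces a passage through the root \<open>par x\<close>. Either way the
  edge at \<open>x'\<close> is ve-dominated by \<open>par x\<close>, which is already selected. An
  edge from \<open>x\<close> to its parent is postponed until the parent is treated, since its
  dominators may include the grandparent, outside the subtree of \<open>par x\<close>. Each list is
  thus traversed at most three times: in the search, to probe its vertex, and to mark the neighbours
  of a selected vertex.\<close>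

fun sem :: "com \<Rightarrow> state \<Rightarrow> state" where
  "sem (Assign x a b) s = s(x := (s x)(aval a s := aval b s))"
| "sem (Seq c d) s = sem d (sem c s)"
| "sem (If b c d) s = (if bval b s then sem c s else sem d s)"
| "sem _ s = s"

text \<open>With \<open>sem\<close> and \<open>cost\<close>, this treats loop-free commands only:
  \<open>sem\<close> has a dummy value at \<open>While\<close>, which \<open>safe\<close> rules out.
  Loops are left to \<open>exec_While\<close>.\<close>

fun safe :: "nat \<Rightarrow> com \<Rightarrow> state \<Rightarrow> bool" where
  "safe w Skip s \<longleftrightarrow> True"
| "safe w (Assign x a b) s \<longleftrightarrow> aval b s \<le> w"
| "safe w (Seq c d) s \<longleftrightarrow> safe w c s \<and> safe w d (sem c s)"
| "safe w (If b c d) s \<longleftrightarrow> (if bval b s then safe w c s else safe w d s)"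
| "safe w (While b c) s \<longleftrightarrow> False"

text \<open>Adding both branches of a conditional gives a bound that depends on the command alone,
  not on the state.\<close>

fun cost :: "com \<Rightarrow> nat" where
  "cost Skip = 1"
| "cost (Assign x a b) = acost a + acost b + 1"
| "cost (Seq c d) = cost c + cost d"
| "cost (If b c d) = bcost b + cost c + cost d + 1"
| "cost (While b c) = 0"

lemma exec_sem: "safe w c s \<Longrightarrow> \<exists>t \<le> cost c. exec w c s t (sem c s)"
proof (induction c arbitrary: s)
  case Skip
  then show ?case using exec.Skip by auto
next
  case (Assign x a b)
  then show ?case using exec.Assign[of b s w x a]
    by (intro exI[of _ "acost a + acost b + 1"]) (simp add: fun_upd_def)
next
  case (Seq c d)
  then obtain t u where "t \<le> cost c" "exec w c s t (sem c s)"
    "u \<le> cost d" "exec w d (sem c s) u (sem d (sem c s))" by force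
  then show ?case using exec.Seq by (fastforce intro!: exI[of _ "t + u"])
next
  case (If b c d)
  show ?case
  proof (cases "bval b s")
    case True
    with If obtain t where "t \<le> cost c" "exec w c s t (sem c s)" by force
    with True show ?thesis
      using exec.IfTrue[OF True] by (auto intro!: exI[of _ "bcost b + t + 1"])
  next
    case False
    with If obtain t where "t \<le> cost d" "exec w d s t (sem d s)" by force
    with False show ?thesis
      using exec.IfFalse[OF False] by (auto intro!: exI[of _ "bcost b + t + 1"])
  qed
qed simp

text \<open>Besides being an invariant, \<open>I k s\<close> bounds the number of remaining iterations by \<open>k\<close>; the index
  may depend on ghost values that the invariant hides behind an existential quantifier.\<close>

lemma exec_While:
  assumes step: "\<And>k s. I k s \<Longrightarrow> bval b s \<Longrightarrow> safe w c s \<and> (\<exists>k' < k. I k' (sem c s))"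
    and "I k s"
  shows "\<exists>t s' k'. exec w (While b c) s t s' \<and> I k' s' \<and> \<not> bval b s' \<and>
    t \<le> (bcost b + cost c + 1) * (k + 1)"
  using \<open>I k s\<close>
proof (induction k arbitrary: s rule: less_induct)
  case (less k)
  show ?case
  proof (cases "bval b s")
    case False
    then show ?thesis using less.prems exec.WhileFalse[OF False, of w c]
      by (intro exI[of _ "bcost b + 1"] exI[of _ s] exI[of _ k]) auto
  next
    case True
    with step less.prems obtain l where l: "l < k" "I l (sem c s)" and "safe w c s" by blast
    then obtain t where t: "t \<le> cost c" "exec w c s t (sem c s)" using exec_sem by blast
    from less.IH[OF l] obtain u s' k' where u: "exec w (While b c) (sem c s) u s'" "I k' s'"
      "\<not> bval b s'" "u \<le> (bcost b + cost c + 1) * (l + 1)" by blast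
    have "(bcost b + cost c + 1) * (l + 1) + (bcost b + cost c + 1)
        = (bcost b + cost c + 1) * (l + 2)" by simp
    also have "\<dots> \<le> (bcost b + cost c + 1) * (k + 1)"
      using l(1) by (intro mult_left_mono) auto
    finally have "bcost b + t + u + 1 \<le> (bcost b + cost c + 1) * (k + 1)"
      using t(1) u(4) by linarith
    then show ?thesis using exec.WhileTrue[OF True t(2) u(1)] u(2,3) by blast
  qed
qed

section \<open>Cycles in block graphs\<close>

text \<open>Curried, so that walks can be written with \<open>successively\<close>.\<close>

definition adjacent :: "'a set set \<Rightarrow> 'a \<Rightarrow> 'a \<Rightarrow> bool" where
  "adjacent E u v \<longleftrightarrow> {u, v} \<in> E"

lemma reachable_refl: "reachable E a a"
  by (simp add: reachable_def)

lemma reachable_trans: "reachable E a b \<Longrightarrow> reachable E b c \<Longrightarrow> reachable E a c"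
  unfolding reachable_def by (rule rtrancl_trans)

lemma reachable_sym: "reachable E a b \<Longrightarrow> reachable E b a"
proof -
  have "sym {(x, y). {x, y} \<in> E}" by (auto simp: sym_def insert_commute)
  then show "reachable E a b \<Longrightarrow> reachable E b a"
    unfolding reachable_def by (metis sym_rtrancl symD)
qed

lemma reachable_edge: "{a, b} \<in> E \<Longrightarrow> reachable E a b"
  unfolding reachable_def by auto

lemma reachable_walk:
  assumes "successively (adjacent E) xs" "set xs \<subseteq> W" "a \<in> set xs" "b \<in> set xs"
  shows "reachable (induced_edges E W) a b"
proof -
  have "reachable (induced_edges E W) (hd xs) a" if "a \<in> set xs" for a
    using assms(1,2) that
  proof (induction xs arbitrary: a)
    case (Cons x xs)
    show ?case
    proof (cases "a = x \<or> xs = []")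
      case True
      then show ?thesis using Cons.prems by (auto simp: reachable_refl)
    next
      case False
      then have "successively (adjacent E) xs" "set xs \<subseteq> W" "a \<in> set xs"
        using Cons.prems by (auto simp: successively_Cons)
      then have "reachable (induced_edges E W) (hd xs) a" by (rule Cons.IH)
      moreover have "{x, hd xs} \<in> induced_edges E W"
        using Cons.prems False by (auto simp: successively_Cons adjacent_def induced_edges_def)
      ultimately show ?thesis using reachable_trans[OF reachable_edge] by simp
    qed
  qed simp
  then show ?thesis using assms(3,4) by (blast intro: reachable_sym reachable_trans)
qed

lemma card_components_le_1:
  assumes "\<And>a b. a \<in> W \<Longrightarrow> b \<in> W \<Longrightarrow> reachable F a b"
  shows "card (components W F) \<le> 1"
proof -
  have "components W F \<subseteq> {W}" using assms unfolding components_def by auto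
  then show ?thesis using card_mono[of "{W}"] by auto
qed

text \<open>By finiteness \<open>W\<close> extends to a maximal set of this kind, which is a block;
  completeness passes down to subsets.\<close>

lemma complete_on_connected_without_cut_vertex:
  assumes "block_graph V E" "W \<subseteq> V" "connected_without_cut_vertex W (induced_edges E W)"
  shows "complete_on E W"
proof -
  define \<C> where "\<C> = {C. W \<subseteq> C \<and> C \<subseteq> V \<and> connected_without_cut_vertex C (induced_edges E C)}"
  have "finite V" using assms(1) by (simp add: block_graph_def simple_graph_def)
  then have "finite \<C>" unfolding \<C>_def
    by (auto intro: finite_subset[of _ "Pow V"])
  moreover have "W \<in> \<C>" using assms unfolding \<C>_def by simp
  ultimately obtain B where B: "B \<in> \<C>" "W \<subseteq> B" "\<And>C. C \<in> \<C> \<Longrightarrow> B \<subseteq> C \<Longrightarrow> C = B"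
    using finite_has_maximal2[of \<C> W] by metis
  then have "is_block V E B" unfolding is_block_def \<C>_def by blast
  then have "complete_on E B" using assms(1) by (simp add: block_graph_def)
  then show ?thesis using B(2) unfolding complete_on_def by blast
qed

text \<open>Deleting \<open>v\<close> from \<open>ys @ v # zs\<close> leaves the walk
  \<open>zs @ ys\<close>, joined by the closing edge. So a cycle has no cut vertex of its
  own.\<close>

lemma complete_on_cycle:
  assumes "block_graph V E" "successively (adjacent E) xs" "distinct xs" "xs \<noteq> []"
    "set xs \<subseteq> V" "adjacent E (last xs) (hd xs)"
  shows "complete_on E (set xs)"
proof (rule complete_on_connected_without_cut_vertex[OF assms(1,5)])
  let ?W = "set xs" and ?F = "induced_edges E (set xs)"
  have conn: "connected_graph ?W ?F"
    using assms(2,4) reachable_walk unfolding connected_graph_def by fastforce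
  have "\<not> cut_vertex ?W ?F v" for v
  proof
    assume cut: "cut_vertex ?W ?F v"
    then have "v \<in> ?W" unfolding cut_vertex_def by blast
    then obtain ys zs where xs: "xs = ys @ v # zs" using split_list by metis
    let ?U = "set (zs @ ys)"
    have U: "?W - {v} = ?U" using xs assms(3) by auto
    have walk: "successively (adjacent E) (zs @ ys)"
      using assms(2,6) unfolding xs
      by (cases "ys = []"; cases "zs = []")
         (auto simp: successively_append_iff successively_Cons)
    have "induced_edges ?F ?U = induced_edges E ?U"
      using U unfolding induced_edges_def by blast
    then have "card (components ?U (induced_edges ?F ?U)) \<le> 1"
      using reachable_walk[OF walk] by (intro card_components_le_1) auto
    moreover have "card (components ?W ?F) > 0"
      using assms(4) unfolding components_def by (simp add: card_gt_0_iff)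
    ultimately show False using cut U unfolding cut_vertex_def by simp
  qed
  then show "connected_without_cut_vertex ?W ?F"
    using conn unfolding connected_without_cut_vertex_def by blast
qed

text \<open>When the next vertex already lies on the path, the path is cut off there.\<close>

lemma distinct_walk:
  assumes "(x, y) \<in> {(a, b). R a b}\<^sup>*"
  shows "\<exists>xs. xs \<noteq> [] \<and> hd xs = x \<and> last xs = y \<and> distinct xs \<and> successively R xs"
  using assms
proof (induction rule: rtrancl_induct)
  case base
  show ?case by (rule exI[of _ "[x]"]) simp
next
  case (step y z)
  then obtain xs where xs: "xs \<noteq> []" "hd xs = x" "last xs = y" "distinct xs" "successively R xs"
    by blast
  show ?case
  proof (cases "z \<in> set xs")
    case True
    then obtain ys zs where "xs = ys @ z # zs" using split_list by metis
    then show ?thesis using xs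
      by (intro exI[of _ "ys @ [z]"]) (auto simp: successively_append_iff hd_append split: if_splits)
  next
    case False
    then show ?thesis using xs step(2)
      by (intro exI[of _ "xs @ [z]"]) (auto simp: successively_append_iff)
  qed
qed

lemma successively_restrict:
  assumes "successively (\<lambda>a b. R a b \<and> P a \<and> P b) xs" "P (hd xs)" "x \<in> set xs"
  shows "P x"
  using assms
proof (induction xs)
  case (Cons a xs)
  show ?case
  proof (cases "x = a")
    case False
    then have "x \<in> set xs" using Cons.prems(3) by simp
    moreover from this have "xs \<noteq> []" by auto
    moreover from this have "successively (\<lambda>a b. R a b \<and> P a \<and> P b) xs" "P (hd xs)"
      using Cons.prems(1) unfolding successively_Cons by blast+
    ultimately show ?thesis using Cons.IH by blast
  qed (use Cons.prems(2) in simp)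
qed simp

section \<open>The greedy algorithm on a search order\<close>

text \<open>Vertices are represented by their positions in the order of discovery.\<close>

locale search_order =
  fixes n :: nat and A :: "nat \<Rightarrow> nat \<Rightarrow> bool" and par :: "nat \<Rightarrow> nat"
  assumes A_sym: "A i j \<Longrightarrow> A j i"
    and A_irrefl: "\<not> A i i"
    and A_less: "A i j \<Longrightarrow> i < n"
    and par_le: "i < n \<Longrightarrow> par i \<le> i"
    and par_edge: "i < n \<Longrightarrow> par i \<noteq> i \<Longrightarrow> A (par i) i"
    and par_mono: "i \<le> j \<Longrightarrow> j < n \<Longrightarrow> par i \<le> par j"
    and par_early: "A i j \<Longrightarrow> i < j \<Longrightarrow> par j \<le> i"
    and cycle_complete: "successively A xs \<Longrightarrow> distinct xs \<Longrightarrow> xs \<noteq> [] \<Longrightarrow> A (last xs) (hd xs) \<Longrightarrow>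
      a \<in> set xs \<Longrightarrow> b \<in> set xs \<Longrightarrow> a \<noteq> b \<Longrightarrow> A a b"
begin

text \<open>Climbing from the larger end to its parent decreases \<open>u + v\<close>. If the parent
  falls below \<open>u\<close>, the ends swap roles, and monotonicity of \<open>par\<close> keeps
  roots out of the new segment. The bound \<open>k\<close> stays fixed, so that the path avoids all
  later positions.\<close>

lemma segment_connected:
  assumes "u \<le> v" "v < n" "v \<le> k" "\<And>r. u < r \<Longrightarrow> r \<le> v \<Longrightarrow> par r \<noteq> r"
  shows "(u, v) \<in> {(a, b). A a b \<and> a \<le> k \<and> b \<le> k}\<^sup>*"
  using assms
proof (induction "u + v" arbitrary: u v rule: less_induct)
  case less
  let ?R = "{(a, b). A a b \<and> a \<le> k \<and> b \<le> k}"
  show ?case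
  proof (cases "u = v")
    case False
    then have p: "par v \<noteq> v" using less.prems by simp
    then have "par v < v" using less.prems par_le[of v] by simp
    note p = p this
    then have "A (par v) v" using par_edge less.prems by blast
    then have edge: "(par v, v) \<in> ?R" "(v, par v) \<in> ?R" using p less.prems A_sym by auto
    have "(u, par v) \<in> ?R\<^sup>*"
    proof (cases "u \<le> par v")
      case True
      then show ?thesis using p less.prems by (intro less.hyps) auto
    next
      case False
      have "(par v, u) \<in> ?R\<^sup>*"
      proof (rule less.hyps)
        fix r assume "par v < r" "r \<le> u"
        then show "par r \<noteq> r" using par_mono[of r v] less.prems by force
      qed (use False p less.prems in auto)
      moreover have "sym ?R" using A_sym by (auto simp: sym_def)
      ultimately show ?thesis by (meson sym_rtrancl symD)
    qed
    then show ?thesis using edge by (meson rtrancl.rtrancl_into_rtrancl)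
  qed simp
qed

text \<open>Monotonicity of \<open>par\<close> excludes roots strictly after \<open>par j\<close>
  and up to \<open>i\<close>, so a path of positions at most \<open>i\<close> joins these two.
  Adding \<open>j > i\<close> closes it to a cycle, which is complete.\<close>

lemma adjacent_par:
  assumes "A i j" "i < j" "par j \<noteq> i"
  shows "A (par j) i"
proof -
  have lt: "par j < i" using par_early[OF assms(1,2)] assms(3) by simp
  have n: "j < n" "i < n" using A_less A_sym assms by blast+
  have "(par j, i) \<in> {(a, b). A a b \<and> a \<le> i \<and> b \<le> i}\<^sup>*"
  proof (rule segment_connected)
    fix r assume "par j < r" "r \<le> i"
    then show "par r \<noteq> r" using par_mono[of r j] assms(2) n by force
  qed (use lt n in auto)
  then obtain xs where xs: "xs \<noteq> []" "hd xs = par j" "last xs = i" "distinct xs"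
    "successively (\<lambda>a b. A a b \<and> a \<le> i \<and> b \<le> i) xs"
    using distinct_walk[of "par j" i "\<lambda>a b. A a b \<and> a \<le> i \<and> b \<le> i"] by auto
  have le: "x \<le> i" if "x \<in> set xs" for x
    using successively_restrict[OF xs(5)] xs(2) lt that by simp
  have "successively A xs" using successively_mono[OF xs(5)] by simp
  moreover have "A j (par j)" "A i j"
    using A_sym[OF par_edge[OF n(1)]] lt assms by auto
  moreover have "par j \<in> set xs" "i \<in> set xs"
    using hd_in_set[OF xs(1)] last_in_set[OF xs(1)] xs(2,3) by simp_all
  moreover have "j \<notin> set xs" using le assms(2) by fastforce
  ultimately show ?thesis
    using xs(1-4) lt by - (rule cycle_complete[of "j # xs"], auto simp: successively_Cons)
qed

text \<open>Otherwise \<open>r = par i\<close> and \<open>p = par j\<close> satisfy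
  \<open>r < p < i < j\<close>, and \<open>adjacent_par\<close>, used twice, yields the cycle
  \<open>j, i, r, p\<close>. Its chord from \<open>r\<close> to \<open>j\<close> would give
  \<open>j\<close> a neighbour earlier than its parent.\<close>

lemma adjacent_cases:
  assumes "A i j" "i < j"
  shows "par j = i \<or> par j = par i"
proof (rule ccontr)
  assume neg: "\<not> (par j = i \<or> par j = par i)"
  define p where "p = par j"
  define r where "r = par i"
  have n: "j < n" "i < n" using A_less A_sym assms by blast+
  have p: "A p i" "p < i" using adjacent_par[OF assms] par_early[OF assms] neg unfolding p_def by auto
  then have r: "r < p" using par_early[of p i] neg unfolding p_def r_def by auto
  have rp: "A r p" using adjacent_par[of p i] p r unfolding r_def by auto
  have "A i r" using par_edge[OF n(2)] r p A_sym unfolding r_def by auto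
  moreover have "A j i" using A_sym assms(1) by blast
  moreover have "A p j" using par_edge[OF n(1)] assms(2) p unfolding p_def by force
  ultimately have "A r j"
    using assms(2) p r rp by - (rule cycle_complete[of "[j, i, r, p]"], auto)
  then show False using par_early[of r j] assms p r unfolding p_def by auto
qed

section \<open>Subtrees of the search forest and ve-dominators\<close>

definition descends :: "nat \<Rightarrow> nat \<Rightarrow> bool" where
  "descends z t \<longleftrightarrow> (\<exists>k. (par ^^ k) z = t)"

lemma descends_refl: "descends t t"
  unfolding descends_def by (rule exI[of _ 0]) simp

lemma descends_par: "descends (par z) t \<Longrightarrow> descends z t"
  unfolding descends_def by (metis comp_apply funpow_Suc_right)

lemma par_descends: "descends z t \<Longrightarrow> z \<noteq> t \<Longrightarrow> descends (par z) t"
  unfolding descends_def by (metis comp_apply funpow_Suc_right funpow_0 not0_implies_Suc)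

lemma descends_le:
  assumes "descends z t" "z < n"
  shows "t \<le> z"
proof -
  have "(par ^^ k) z \<le> z" for k
  proof (induction k)
    case (Suc k)
    then show ?case using assms(2) par_le[of "(par ^^ k) z"] by simp
  qed simp
  then show ?thesis using assms(1) unfolding descends_def by blast
qed

lemma adjacent_par_cases: "A u v \<Longrightarrow> par u = v \<or> par v = u \<or> par u = par v"
  by (metis A_irrefl A_sym adjacent_cases nat_neq_iff)

text \<open>All neighbours of \<open>u\<close> are its parent, its children or its siblings.
  Children stay below \<open>t\<close>, and for \<open>u \<noteq> t\<close> so do the parent and the
  siblings.\<close>

lemma enter_descendants:
  assumes "A u v" "descends u t" "\<not> descends v t"
  shows "u = t"
  using adjacent_par_cases[OF assms(1)] assms(2,3) by (metis descends_par par_descends)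

text \<open>By symmetry of \<open>A\<close>, for an edge between \<open>x\<close> and
  \<open>y\<close> these are exactly its ve-dominators.\<close>

definition dominators :: "nat \<Rightarrow> nat \<Rightarrow> nat set" where
  "dominators x y = {z. z = x \<or> z = y \<or> A x z \<or> A y z}"

text \<open>Here \<open>y\<close> is a sibling or a child of \<open>x\<close>. Neighbours of a child
  of \<open>par x\<close> lie below \<open>par x\<close>, and those of a grandchild even more
  so.\<close>

lemma dominators_descend:
  assumes "A x y" "y \<noteq> par x" "z \<in> dominators x y"
  shows "descends z (par x)"
proof -
  have x: "descends x (par x)" using descends_par descends_refl by blast
  have near: "descends v (par x)" if "A u v" "par u = par x" for u v
    using adjacent_par_cases[OF that(1)] that(2) by (metis descends_par descends_refl)
  have y: "descends y (par x)" using near assms(1) by blast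
  have "descends z (par x)" if "A y z"
  proof (cases "par y = par x")
    case True
    then show ?thesis using near that by blast
  next
    case False
    then have "par y = x" using adjacent_par_cases[OF assms(1)] assms(2) by auto
    then show ?thesis using adjacent_par_cases[OF that] x y by (metis descends_par)
  qed
  then show ?thesis using assms(3) x y near unfolding dominators_def by blast
qed

text \<open>A connected set of positions that meets the descendants of \<open>par x\<close> and also has a member
  outside contains \<open>par x\<close>; the dominators of \<open>x'\<close> and \<open>y'\<close> are such a set because of \<open>par x'\<close>.\<close>

lemma dominators_meet:
  assumes "A x y" "y \<noteq> par x" "A x' y'" "x' < x" "x < n"
    "z \<in> dominators x y" "z \<in> dominators x' y'"
  shows "par x \<in> dominators x' y'"
proof -
  let ?t = "par x" and ?t' = "par x'"
  have t': "?t' \<in> dominators x' y'"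
    using par_edge[of x'] A_sym assms(4,5) unfolding dominators_def by force
  have le: "?t' \<le> ?t" using par_mono assms(4,5) by simp
  have z: "descends z ?t" using dominators_descend assms(1,2,6) by blast
  show ?thesis
  proof (cases "?t' = ?t")
    case False
    have "?t' < n" using par_le[of x'] assms(4,5) by simp
    then have out: "\<not> descends ?t' ?t" using descends_le le False by force
    \<comment> \<open>The chain \<open>?t'\<close>, \<open>x'\<close>, \<open>y'\<close>,
      \<open>z\<close> (possibly without \<open>y'\<close> or \<open>x'\<close>) starts outside the
      subtree of \<open>?t\<close> and ends inside; whichever member enters it first equals
      \<open>?t\<close>.\<close>
    have x': "x' = ?t" if "descends x' ?t"
      using enter_descendants[of x' ?t' ?t] out that par_descends by blast
    have y': "y' = ?t" if "descends y' ?t" "\<not> descends x' ?t"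
      using enter_descendants[of y' x' ?t] assms(3) A_sym that by blast
    have "z = ?t" if "\<not> descends x' ?t" "\<not> descends y' ?t"
      using z assms(7) that enter_descendants A_sym unfolding dominators_def by blast
    then show ?thesis using x' y' assms(7) unfolding dominators_def by blast
  qed (use t' in simp)
qed

section \<open>The greedy invariant and its lower-bound certificate\<close>

definition covers :: "nat set \<Rightarrow> nat \<Rightarrow> bool" where
  "covers S v \<longleftrightarrow> (\<exists>s\<in>S. s = v \<or> A s v)"

text \<open>\<open>X s\<close> and \<open>Y s\<close> are the ends of the undominated edge that
  caused the selection of \<open>s\<close>.\<close>

definition packing :: "nat \<Rightarrow> nat set \<Rightarrow> (nat \<Rightarrow> nat) \<Rightarrow> (nat \<Rightarrow> nat) \<Rightarrow> bool" where
  "packing i S X Y \<longleftrightarrow>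
     (\<forall>s\<in>S. i \<le> X s \<and> par (X s) = s \<and> A (X s) (Y s) \<and> Y s \<noteq> s) \<and>
     (\<forall>s\<in>S. \<forall>s'\<in>S. s \<noteq> s' \<longrightarrow> dominators (X s) (Y s) \<inter> dominators (X s') (Y s') = {})"

text \<open>The loop invariant once all positions from \<open>i\<close> on are treated. An edge is
  ve-dominated iff one of its ends is covered; an edge to the parent counts only at the
  parent.\<close>

definition greedy :: "nat \<Rightarrow> nat set \<Rightarrow> bool" where
  "greedy i S \<longleftrightarrow> finite S \<and> S \<subseteq> {..<n} \<and>
     (\<forall>x y. i \<le> x \<longrightarrow> A x y \<longrightarrow> y \<noteq> par x \<longrightarrow> covers S x \<or> covers S y) \<and>
     (\<exists>X Y. packing i S X Y)"

lemma greedy_empty: "greedy n {}"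
  using A_less unfolding greedy_def packing_def by force

lemma packing_Suc: "packing (Suc i) S X Y \<Longrightarrow> packing i S X Y"
  unfolding packing_def by auto

lemma greedy_skip:
  assumes "greedy (Suc i) S" "\<And>y. A i y \<Longrightarrow> y \<noteq> par i \<Longrightarrow> covers S i \<or> covers S y"
  shows "greedy i S"
proof -
  have "covers S x \<or> covers S y" if "i \<le> x" "A x y" "y \<noteq> par x" for x y
  proof (cases "x = i")
    case False
    then show ?thesis using that assms(1) unfolding greedy_def by auto
  qed (use that assms(2) in blast)
  then show ?thesis using assms(1) packing_Suc unfolding greedy_def by blast
qed

text \<open>Old witnesses have \<open>X s > i\<close>. If their dominators met those of the new
  edge, \<open>dominators_meet\<close> would put \<open>s\<close> itself among the latter, although
  neither end is covered.\<close>

lemma packing_add: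
  assumes "packing (Suc i) S X Y" "A i y" "y \<noteq> par i" "\<not> covers S i" "\<not> covers S y" "par i \<notin> S"
  shows "packing i (insert (par i) S) (X(par i := i)) (Y(par i := y))"
proof -
  have X: "Suc i \<le> X s" "par (X s) = s" "A (X s) (Y s)" "Y s \<noteq> s" if "s \<in> S" for s
    using assms(1) that unfolding packing_def by auto
  have disj: "dominators (X s) (Y s) \<inter> dominators i y = {}" if "s \<in> S" for s
  proof (rule ccontr)
    assume "\<not> ?thesis"
    then have "par (X s) \<in> dominators i y"
      using dominators_meet[of "X s" "Y s" i y] X[OF that] A_less assms(2) by auto
    then have "s = i \<or> s = y \<or> A s i \<or> A s y"
      using X(2)[OF that] A_sym unfolding dominators_def by auto
    then show False using that assms(4,5) unfolding covers_def by blast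
  qed
  have "\<forall>s\<in>S. \<forall>s'\<in>S. s \<noteq> s' \<longrightarrow> dominators (X s) (Y s) \<inter> dominators (X s') (Y s') = {}"
    using assms(1) unfolding packing_def by blast
  moreover have "s \<noteq> par i" if "s \<in> S" for s using that assms(6) by blast
  moreover have "i \<le> X s" if "s \<in> S" for s using X(1)[OF that] by simp
  ultimately show ?thesis
    using X(2-4) assms(2,3) disj unfolding packing_def by (simp add: Int_commute)
qed

text \<open>The vertex \<open>par i\<close> covers \<open>i\<close>. Hence it was not selected
  before, and selecting it settles all edges at \<open>i\<close> at once.\<close>

lemma greedy_add:
  assumes "greedy (Suc i) S" "A i y" "y \<noteq> par i" "\<not> covers S i" "\<not> covers S y"
  shows "par i \<notin> S" "greedy i (insert (par i) S)"
proof -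
  let ?t = "par i"
  have i: "i < n" using A_less assms(2) by blast
  then have t: "?t < n" "?t = i \<or> A ?t i" using par_le[of i] par_edge[of i] by auto
  show notin: "?t \<notin> S" using assms(4) t(2) unfolding covers_def by blast
  have "covers (insert ?t S) x \<or> covers (insert ?t S) z"
    if "i \<le> x" "A x z" "z \<noteq> par x" for x z
  proof (cases "x = i")
    case True
    then show ?thesis using t(2) unfolding covers_def by blast
  next
    case False
    then have "covers S x \<or> covers S z" using that assms(1) unfolding greedy_def by auto
    then show ?thesis unfolding covers_def by blast
  qed
  moreover have "\<exists>X Y. packing i (insert ?t S) X Y"
    using assms packing_add notin unfolding greedy_def by blast
  moreover have "finite (insert ?t S)" "insert ?t S \<subseteq> {..<n}"
    using assms(1) t unfolding greedy_def by auto
  ultimately show "greedy i (insert ?t S)" unfolding greedy_def by blast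
qed

text \<open>An edge to the parent is seen from its other end, where it is not a parent edge.\<close>

lemma greedy_dominates:
  assumes "greedy 0 S" "A x y"
  shows "covers S x \<or> covers S y"
proof (cases "y = par x")
  case True
  then have "x \<noteq> par y" using assms(2) A_less A_sym A_irrefl par_le by (metis order_antisym)
  then show ?thesis using assms A_sym unfolding greedy_def by blast
next
  case False
  then show ?thesis using assms unfolding greedy_def by blast
qed

lemma greedy_minimal:
  assumes "greedy i S" "finite T" "\<And>x y. A x y \<Longrightarrow> covers T x \<or> covers T y"
  shows "card S \<le> card T"
proof -
  obtain X Y where XY: "\<And>s. s \<in> S \<Longrightarrow> A (X s) (Y s)"
    "\<And>s s'. s \<in> S \<Longrightarrow> s' \<in> S \<Longrightarrow> s \<noteq> s' \<Longrightarrow> dominators (X s) (Y s) \<inter> dominators (X s') (Y s') = {}"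
    using assms(1) unfolding greedy_def packing_def by blast
  have "\<exists>z. z \<in> T \<and> z \<in> dominators (X s) (Y s)" if "s \<in> S" for s
    using assms(3)[OF XY(1)[OF that]] A_sym unfolding covers_def dominators_def by blast
  then obtain g where g: "\<And>s. s \<in> S \<Longrightarrow> g s \<in> T \<and> g s \<in> dominators (X s) (Y s)" by metis
  then have "inj_on g S" using XY(2) unfolding inj_on_def by (metis disjoint_iff)
  then show ?thesis using card_inj_on_le[of g S T] g assms(2) by blast
qed

end

section \<open>Adjacency lists\<close>

lemma gamma_ve_eq_card:
  assumes "min_ve_dominating_set V E S"
  shows "gamma_ve V E = card S"
  unfolding gamma_ve_def
proof (rule Least_equality)
  show "\<exists>T. ve_dominating_set V E T \<and> card T = card S"
    using assms unfolding min_ve_dominating_set_def by blast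
qed (use assms in \<open>auto simp: min_ve_dominating_set_def\<close>)

locale listed_graph =
  fixes n :: nat and E :: "nat set set" and adj :: "nat list list"
  assumes simple: "simple_graph {..<n} E"
    and lists: "adjacency_lists n E adj"
begin

definition off :: "nat \<Rightarrow> nat" where
  "off i = length (concat (take i adj))"

definition flat :: "nat list" where
  "flat = concat adj"

definition deg :: "nat \<Rightarrow> nat" where
  "deg v = length (adj ! v)"

lemma length_adj: "length adj = n"
  using lists by (simp add: adjacency_lists_def)

lemma edge_less: "{u, v} \<in> E \<Longrightarrow> u < n \<and> v < n"
  using simple by (auto simp: simple_graph_def)

lemma edge_neq: "{u, v} \<in> E \<Longrightarrow> u \<noteq> v"
  using simple by (auto simp: simple_graph_def)

lemma off_0: "off 0 = 0"
  by (simp add: off_def)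

lemma off_Suc: "v < n \<Longrightarrow> off (Suc v) = off v + deg v"
  by (simp add: off_def deg_def take_Suc_conv_app_nth length_adj)

lemma off_n: "off n = length flat"
  by (simp add: off_def flat_def length_adj)

lemma off_le: "i \<le> n \<Longrightarrow> off i \<le> length flat"
proof -
  have "off i + length (concat (drop i adj)) = length flat"
    unfolding off_def flat_def by (metis append_take_drop_id concat_append length_append)
  then show ?thesis by simp
qed

lemma sum_deg: "(\<Sum>v<n. deg v) = length flat"
proof -
  have "i \<le> n \<Longrightarrow> (\<Sum>v<i. deg v) = off i" for i
    by (induction i) (auto simp: off_0 off_Suc)
  then show ?thesis using off_n by simp
qed

lemma flat_segment:
  assumes "v < n"
  shows "(!) flat ` {off v..<off (Suc v)} = {u. {v, u} \<in> E}"
proof -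
  have "flat = concat (take v adj) @ adj ! v @ concat (drop (Suc v) adj)"
    unfolding flat_def using assms length_adj by (metis concat_append concat.simps(2) id_take_nth_drop)
  then have nth: "flat ! (off v + k) = (adj ! v) ! k" if "k < deg v" for k
    using that by (simp add: nth_append off_def deg_def)
  have seg: "{off v..<off (Suc v)} = (+) (off v) ` {0..<deg v}"
    using assms by (simp add: off_Suc add.commute)
  have "(!) flat ` {off v..<off (Suc v)} = (!) (adj ! v) ` {0..<deg v}"
    unfolding seg image_image by (rule image_cong) (simp_all add: nth)
  also have "\<dots> = set (adj ! v)" by (auto simp: deg_def set_conv_nth)
  finally show ?thesis using lists assms by (simp add: adjacency_lists_def)
qed

lemma flat_edge: "v < n \<Longrightarrow> off v \<le> p \<Longrightarrow> p < off (Suc v) \<Longrightarrow> {v, flat ! p} \<in> E"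
  using flat_segment[of v] by auto

text \<open>Double counting of incidences; this turns bounds in list entries into bounds in
  edges.\<close>

lemma length_flat_le: "length flat \<le> 2 * card E"
proof -
  have fin: "finite E"
    using simple unfolding simple_graph_def by (auto intro: finite_subset[of _ "Pow {..<n}"])
  have "deg v \<le> card {e \<in> E. v \<in> e}" if "v < n" for v
  proof -
    have "deg v = card {u. {v, u} \<in> E}"
      using lists that distinct_card unfolding adjacency_lists_def deg_def by metis
    also have "\<dots> \<le> card {e \<in> E. v \<in> e}"
      using fin by (intro card_inj_on_le[of "\<lambda>u. {v, u}"]) (auto simp: inj_on_def doubleton_eq_iff)
    finally show ?thesis .
  qed
  then have "length flat \<le> (\<Sum>v<n. card {e \<in> E. v \<in> e})"
    unfolding sum_deg[symmetric] by (intro sum_mono) simp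
  also have "\<dots> = (\<Sum>e\<in>E. card {v \<in> {..<n}. v \<in> e})"
    by (rule sum_multicount_gen) (use fin in auto)
  also have "\<dots> \<le> (\<Sum>e\<in>E. 2)"
  proof (rule sum_mono)
    fix e assume "e \<in> E"
    then have "card e = 2" "e \<subseteq> {..<n}" using simple by (auto simp: simple_graph_def)
    then show "card {v \<in> {..<n}. v \<in> e} \<le> 2"
      by (metis (no_types, lifting) Collect_mem_eq Collect_cong lessThan_iff order_refl subset_iff)
  qed
  finally show ?thesis by simp
qed

end

section \<open>Breadth-first search\<close>

text \<open>The queue \<open>q\<close> holds the \<open>t\<close> discovered vertices, of which the first \<open>h\<close> have been removed, and \<open>par\<close>
  maps positions to positions. The last removed vertex still has the part \<open>{p..<e}\<close> of its list to
  be scanned; the vertices below \<open>r\<close> have been tried as roots.\<close>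

locale searching = listed_graph n E adj for n E adj +
  fixes q par seen :: "nat \<Rightarrow> nat" and t h r p e :: nat
  assumes h_le: "h \<le> t"
    and r_le: "r \<le> n"
    and inj: "inj_on q {..<t}"
    and q_less: "i < t \<Longrightarrow> q i < n"
    and seen_iff: "v < n \<Longrightarrow> seen v \<noteq> 0 \<longleftrightarrow> v \<in> q ` {..<t}"
    and below_r: "v < r \<Longrightarrow> v \<in> q ` {..<t}"
    and par_le: "i < t \<Longrightarrow> par i \<le> i"
    and par_edge: "i < t \<Longrightarrow> par i \<noteq> i \<Longrightarrow> {q (par i), q i} \<in> E"
    and par_h: "i < t \<Longrightarrow> par i \<le> h"
    and par_mono: "i \<le> j \<Longrightarrow> j < t \<Longrightarrow> par i \<le> par j"
    and neighbour: "i < h \<Longrightarrow> {q i, v} \<in> E \<Longrightarrow>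
      v \<in> q ` {..<t} \<or> (Suc i = h \<and> v \<in> (!) flat ` {p..<e})"
    and early: "i < h \<Longrightarrow> j < t \<Longrightarrow> i < j \<Longrightarrow> {q i, q j} \<in> E \<Longrightarrow> par j \<le> i"
    and scan_h: "p < e \<Longrightarrow> 0 < h"
    and scan_par: "p < e \<Longrightarrow> i < t \<Longrightarrow> par i < h"
    and scan_p: "p < e \<Longrightarrow> off (q (h - 1)) \<le> p"
    and scan_e: "p < e \<Longrightarrow> e = off (Suc (q (h - 1)))"
begin

lemma t_le: "t \<le> n"
  using card_inj_on_le[of q "{..<t}" "{..<n}"] inj q_less by auto

text \<open>Common to both kinds of discovery: \<open>f\<close> is the position of the parent, and
  \<open>f = t\<close> makes \<open>v\<close> a root. The hypotheses keep \<open>par\<close>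
  monotone and let no removed neighbour of \<open>v\<close> precede its parent.\<close>

lemma push:
  assumes v: "v < n" "seen v = 0"
    and f: "f \<le> t" "\<And>i. i < t \<Longrightarrow> par i \<le> f" "f \<le> h" "f \<noteq> t \<Longrightarrow> {q f, v} \<in> E"
      "\<And>i. i < h \<Longrightarrow> {q i, v} \<in> E \<Longrightarrow> f \<le> i" "p < e \<Longrightarrow> f < h"
  shows "searching n E adj (q(t := v)) (par(t := f)) (seen(v := Suc 0)) (Suc t) h r p e"
proof
  have new: "v \<notin> q ` {..<t}" using seen_iff v by blast
  have img: "(q(t := v)) ` {..<Suc t} = insert v (q ` {..<t})"
    unfolding lessThan_Suc by auto
  show "inj_on (q(t := v)) {..<Suc t}"
    using inj new unfolding lessThan_Suc by (auto simp: inj_on_def)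
  show "h \<le> Suc t" "r \<le> n" using h_le r_le by auto
  show "(q(t := v)) i < n" if "i < Suc t" for i using that q_less v by (cases "i = t") auto
  show "(seen(v := Suc 0)) u \<noteq> 0 \<longleftrightarrow> u \<in> (q(t := v)) ` {..<Suc t}" if "u < n" for u
    unfolding img using seen_iff[OF that] by auto
  show "u \<in> (q(t := v)) ` {..<Suc t}" if "u < r" for u
    unfolding img using below_r[OF that] by blast
  show "(par(t := f)) i \<le> i" "(par(t := f)) i \<le> h" if "i < Suc t" for i
    using that par_le[of i] par_h[of i] f by (cases "i = t"; simp)+
  show "{(q(t := v)) ((par(t := f)) i), (q(t := v)) i} \<in> E"
    if "i < Suc t" "(par(t := f)) i \<noteq> i" for i
  proof (cases "i = t")
    case True
    then show ?thesis using that f(1,4) by auto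
  next
    case False
    then have "i < t" using that by simp
    then show ?thesis using that False par_edge[of i] par_le[of i] by auto
  qed
  show "(par(t := f)) i \<le> (par(t := f)) j" if "i \<le> j" "j < Suc t" for i j
    using that par_mono[of i j] f(2)[of i] by (cases "j = t"; cases "i = t") auto
  show "u \<in> (q(t := v)) ` {..<Suc t} \<or> (Suc i = h \<and> u \<in> (!) flat ` {p..<e})"
    if "i < h" "{(q(t := v)) i, u} \<in> E" for i u
    unfolding img using neighbour[of i u] that h_le by auto
  show "(par(t := f)) j \<le> i"
    if "i < h" "j < Suc t" "i < j" "{(q(t := v)) i, (q(t := v)) j} \<in> E" for i j
    using that early[of i j] f(5)[of i] h_le by (cases "j = t") auto
  show "0 < h" if "p < e" using scan_h that .
  show "(par(t := f)) i < h" if "p < e" "i < Suc t" for i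
    using that scan_par[of i] f(6) by (cases "i = t") auto
  show "off ((q(t := v)) (h - 1)) \<le> p" "e = off (Suc ((q(t := v)) (h - 1)))" if "p < e"
    using scan_p[OF that] scan_e[OF that] scan_h[OF that] h_le by auto
qed

lemma scanned:
  assumes "p < e"
  shows "{q (h - 1), flat ! p} \<in> E" "e \<le> length flat" "flat ! p < n"
proof -
  have "h - 1 < t" using scan_h[OF assms] h_le by simp
  then have q: "q (h - 1) < n" by (rule q_less)
  show edge: "{q (h - 1), flat ! p} \<in> E"
    using flat_edge[OF q scan_p[OF assms]] scan_e[OF assms] assms by simp
  show "e \<le> length flat" using off_le[of "Suc (q (h - 1))"] q scan_e[OF assms] by simp
  show "flat ! p < n" using edge_less[OF edge] by simp
qed

lemma scan_seen:
  assumes p: "p < e" "seen (flat ! p) \<noteq> 0"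
  shows "searching n E adj q par seen t h r (Suc p) e"
proof
  have found: "flat ! p \<in> q ` {..<t}" using seen_iff scanned(3) p by blast
  have seg: "{p..<e} = insert p {Suc p..<e}" using p(1) by auto
  show "v \<in> q ` {..<t} \<or> (Suc i = h \<and> v \<in> (!) flat ` {Suc p..<e})"
    if "i < h" "{q i, v} \<in> E" for i v
    using neighbour[OF that] found unfolding seg by auto
  show "off (q (h - 1)) \<le> Suc p" using scan_p[OF p(1)] by simp
qed (use h_le r_le inj q_less seen_iff below_r par_le par_edge par_h par_mono early
      scan_h scan_par scan_e p(1) in auto)

text \<open>The lists of positions before \<open>h - 1\<close> are exhausted, so
  \<open>h - 1\<close> is the only removed neighbour of an undiscovered vertex, hence the right
  parent.\<close>

lemma scan_push:
  assumes p: "p < e" "seen (flat ! p) = 0"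
  shows "searching n E adj (q(t := flat ! p)) (par(t := h - 1)) (seen(flat ! p := Suc 0))
    (Suc t) h r (Suc p) e"
proof (rule searching.scan_seen[OF push])
  have new: "flat ! p \<notin> q ` {..<t}" using seen_iff scanned(3) p by blast
  show "h - 1 \<le> t" using h_le by simp
  show "par i \<le> h - 1" if "i < t" for i using scan_par[OF p(1) that] by simp
  show "h - 1 \<le> i" if "i < h" "{q i, flat ! p} \<in> E" for i
    using neighbour[OF that] new by auto
qed (use p scanned[OF p(1)] scan_h[OF p(1)] in auto)

text \<open>Equality in \<open>par_h\<close> is possible for a root awaiting removal. After the
  removal the same bound yields \<open>scan_par\<close>, and also \<open>early\<close> for the
  position \<open>h\<close>.\<close>

lemma pop:
  assumes p: "\<not> p < e" "h < t"
  shows "searching n E adj q par seen t (Suc h) r (off (q h)) (off (Suc (q h)))"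
proof
  have empty: "{p..<e} = {}" using p by simp
  show "v \<in> q ` {..<t} \<or> (Suc i = Suc h \<and> v \<in> (!) flat ` {off (q h)..<off (Suc (q h))})"
    if "i < Suc h" "{q i, v} \<in> E" for i v
  proof (cases "i = h")
    case True
    then show ?thesis using flat_segment[OF q_less[OF p(2)]] that by simp
  next
    case False
    then show ?thesis using neighbour[of i v] that unfolding empty by simp
  qed
  show "par j \<le> i" if "i < Suc h" "j < t" "i < j" "{q i, q j} \<in> E" for i j
    using early[of i j] par_h[of j] that by (cases "i = h") auto
  show "par i < Suc h" if "i < t" for i using par_h[OF that] by simp
  show "par i \<le> Suc h" if "i < t" for i using par_h[OF that] by simp
qed (use p r_le inj q_less seen_iff below_r par_le par_edge par_mono in auto)

lemma root_seen:
  assumes "r < n" "seen r \<noteq> 0"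
  shows "searching n E adj q par seen t h (Suc r) p e"
proof
  show "v \<in> q ` {..<t}" if "v < Suc r" for v
    using below_r[of v] seen_iff[OF assms(1)] assms(2) that less_Suc_eq by blast
qed (use assms h_le inj q_less seen_iff par_le par_edge par_h par_mono neighbour early
      scan_h scan_par scan_p scan_e in auto)

text \<open>With the queue empty and the last list exhausted, an undiscovered vertex has no
  discovered neighbour, so the condition on earlier neighbours is vacuous.\<close>

lemma root_push:
  assumes p: "\<not> p < e" "\<not> h < t" and r: "r < n" "seen r = 0"
  shows "searching n E adj (q(t := r)) (par(t := t)) (seen(r := Suc 0)) (Suc t) h (Suc r) p e"
proof (rule searching.root_seen[OF push[OF r]])
  have h: "h = t" using p(2) h_le by simp
  then show "t \<le> h" by simp
  show "par i \<le> t" if "i < t" for i using par_h[OF that] h by simp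
  have "r \<notin> q ` {..<t}" using seen_iff[OF r(1)] r(2) by blast
  moreover have "{p..<e} = {}" using p by simp
  ultimately show "t \<le> i" if "i < h" "{q i, r} \<in> E" for i
    using neighbour[OF that] by simp
qed (use p r in auto)

end

section \<open>Greedy selection in a block graph\<close>

text \<open>What the greedy phase retains of the search: \<open>q\<close> enumerates the vertices by
  position, and \<open>par\<close> acts on positions.\<close>

locale searched = listed_graph n E adj for n E adj +
  fixes q par :: "nat \<Rightarrow> nat"
  assumes block: "block_graph {..<n} E"
    and inj: "inj_on q {..<n}"
    and range: "q ` {..<n} = {..<n}"
    and parent_le: "i < n \<Longrightarrow> par i \<le> i"
    and parent_edge: "i < n \<Longrightarrow> par i \<noteq> i \<Longrightarrow> {q (par i), q i} \<in> E"
    and parent_mono: "i \<le> j \<Longrightarrow> j < n \<Longrightarrow> par i \<le> par j"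
    and parent_early: "j < n \<Longrightarrow> i < j \<Longrightarrow> {q i, q j} \<in> E \<Longrightarrow> par j \<le> i"
begin

definition adj_pos :: "nat \<Rightarrow> nat \<Rightarrow> bool" where
  "adj_pos i j \<longleftrightarrow> i < n \<and> j < n \<and> {q i, q j} \<in> E"

lemma q_less: "i < n \<Longrightarrow> q i < n"
  using range by blast

lemma adj_pos_cycle:
  assumes "successively adj_pos xs" "distinct xs" "xs \<noteq> []" "adj_pos (last xs) (hd xs)"
    "a \<in> set xs" "b \<in> set xs" "a \<noteq> b"
  shows "adj_pos a b"
proof -
  have less: "set xs \<subseteq> {..<n}"
  proof
    fix x assume x: "x \<in> set xs"
    have "hd xs < n" using assms(4) by (simp add: adj_pos_def)
    moreover have "successively (\<lambda>a b. adj_pos a b \<and> a < n \<and> b < n) xs"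
      using successively_mono[OF assms(1)] by (simp add: adj_pos_def)
    ultimately show "x \<in> {..<n}" using successively_restrict[of adj_pos "\<lambda>a. a < n" xs x] x by simp
  qed
  have "complete_on E (set (map q xs))"
  proof (rule complete_on_cycle[OF block])
    show "successively (adjacent E) (map q xs)"
      using successively_mono[OF assms(1)] by (simp add: successively_map adj_pos_def adjacent_def)
    show "distinct (map q xs)"
      using assms(2) less inj by (auto simp: distinct_map intro: inj_on_subset)
    show "set (map q xs) \<subseteq> {..<n}" using less q_less by auto
    show "adjacent E (last (map q xs)) (hd (map q xs))"
      using assms(3,4) by (simp add: last_map hd_map adj_pos_def adjacent_def)
  qed (use assms(3) in simp)
  moreover have "q a \<noteq> q b" using inj less assms(5-7) by (auto simp: inj_on_def)
  ultimately show ?thesis using assms(5,6) less unfolding complete_on_def adj_pos_def by auto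
qed

sublocale search_order n adj_pos par
proof
  show "adj_pos j i" if "adj_pos i j" for i j
    using that unfolding adj_pos_def by (simp add: insert_commute)
  show "\<not> adj_pos i i" for i unfolding adj_pos_def using edge_neq by blast
  show "adj_pos (par i) i" if "i < n" "par i \<noteq> i" for i
    using that parent_le[of i] parent_edge[of i] unfolding adj_pos_def by simp
  show "i < n" if "adj_pos i j" for i j using that unfolding adj_pos_def by simp
  show "par j \<le> i" if "adj_pos i j" "i < j" for i j
    using that parent_early unfolding adj_pos_def by blast
qed (fact parent_le parent_mono adj_pos_cycle)+

lemma adj_posI:
  assumes "i < n" "{q i, v} \<in> E"
  shows "\<exists>j. v = q j \<and> adj_pos i j"
proof -
  have "v \<in> q ` {..<n}" unfolding range using edge_less[OF assms(2)] by simp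
  then show ?thesis using assms unfolding adj_pos_def by blast
qed

text \<open>\<open>S\<close> consists of positions, its neighbourhood of vertices, as the array
  \<open>near\<close> is indexed by vertices.\<close>

definition nbhd :: "nat set \<Rightarrow> nat set" where
  "nbhd S = {v. \<exists>s\<in>S. q s = v \<or> {q s, v} \<in> E}"

lemma covers_iff:
  assumes "S \<subseteq> {..<n}" "j < n"
  shows "covers S j \<longleftrightarrow> q j \<in> nbhd S"
proof -
  have "s = j \<or> adj_pos s j \<longleftrightarrow> q s = q j \<or> {q s, q j} \<in> E" if "s \<in> S" for s
    using assms that inj unfolding adj_pos_def by (auto simp: inj_on_def)
  then show ?thesis unfolding covers_def nbhd_def by blast
qed

lemma greedy_min_ve_dominating_set:
  assumes "greedy 0 S"
  shows "min_ve_dominating_set {..<n} E (q ` S)"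
proof -
  have S: "S \<subseteq> {..<n}" "finite S" using assms unfolding greedy_def by auto
  have iff: "(\<exists>u\<in>q ` R. ve_dominates E u e) \<longleftrightarrow> (\<exists>v\<in>e. v \<in> nbhd R)" for R e
    unfolding ve_dominates_def closed_nbhd_def nbhd_def by auto
  have edge: "\<exists>i j. e = {q i, q j} \<and> adj_pos i j" if "e \<in> E" for e
  proof -
    have "card e = 2" using simple that by (auto simp: simple_graph_def)
    then obtain u v where e: "e = {u, v}" by (auto simp: card_2_iff)
    then have "u < n" using edge_less that by blast
    then obtain i where "i < n" "u = q i" using range by blast
    then show ?thesis using adj_posI that e by blast
  qed
  have less: "i < n" "j < n" if "adj_pos i j" for i j using that unfolding adj_pos_def by auto
  have "\<exists>u\<in>q ` S. ve_dominates E u e" if "e \<in> E" for e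
  proof -
    obtain i j where e: "e = {q i, q j}" "adj_pos i j" using edge \<open>e \<in> E\<close> by blast
    then show ?thesis using greedy_dominates[OF assms e(2)] less covers_iff[OF S(1)]
      unfolding iff by auto
  qed
  moreover have "card (q ` S) \<le> card T" if "ve_dominating_set {..<n} E T" for T
  proof -
    define R where "R = {i. i < n \<and> q i \<in> T}"
    have T: "T \<subseteq> {..<n}" using that by (simp add: ve_dominating_set_def)
    have RT: "q ` R = T" using T range unfolding R_def by auto
    have R: "R \<subseteq> {..<n}" "finite R" unfolding R_def by auto
    have "covers R i \<or> covers R j" if "adj_pos i j" for i j
    proof -
      have "{q i, q j} \<in> E" using that unfolding adj_pos_def by blast
      then have "\<exists>u\<in>q ` R. ve_dominates E u {q i, q j}"
        using \<open>ve_dominating_set {..<n} E T\<close> unfolding RT ve_dominating_set_def by blast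
      then show ?thesis using less[OF that] covers_iff[OF R(1)] unfolding iff by auto
    qed
    then have "card S \<le> card R" using greedy_minimal assms R(2) by blast
    moreover have "card (q ` S) = card S" "card (q ` R) = card R"
      using S(1) R(1) inj by (auto intro!: card_image intro: inj_on_subset)
    ultimately show ?thesis using RT by simp
  qed
  moreover have "q ` S \<subseteq> {..<n}" using S(1) q_less by auto
  ultimately show ?thesis unfolding min_ve_dominating_set_def ve_dominating_set_def by blast
qed

text \<open>The states of the greedy loop: \<open>probing\<close> searches the list of \<open>x\<close> for an edge that is not
  ve-dominated, \<open>marking\<close> updates \<open>near\<close> along the list of the newly selected vertex \<open>w\<close>, and at the
  end of either list \<open>idle\<close> holds.\<close>

definition exact :: "(nat \<Rightarrow> nat) \<Rightarrow> nat set \<Rightarrow> bool" where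
  "exact near S \<longleftrightarrow> (\<forall>v<n. near v \<noteq> 0 \<longleftrightarrow> v \<in> nbhd S)"

definition probing :: "nat \<Rightarrow> nat set \<Rightarrow> (nat \<Rightarrow> nat) \<Rightarrow> nat \<Rightarrow> nat \<Rightarrow> nat \<Rightarrow> nat \<Rightarrow> bool" where
  "probing i S near x w p e \<longleftrightarrow> i < n \<and> x = q i \<and> w = q (par i) \<and>
     off x \<le> p \<and> p \<le> e \<and> e = off (Suc x) \<and> greedy (Suc i) S \<and> exact near S \<and>
     (\<forall>k. off x \<le> k \<longrightarrow> k < p \<longrightarrow> flat ! k \<noteq> w \<longrightarrow> x \<in> nbhd S \<or> flat ! k \<in> nbhd S)"

definition marking :: "nat \<Rightarrow> nat set \<Rightarrow> (nat \<Rightarrow> nat) \<Rightarrow> nat \<Rightarrow> nat \<Rightarrow> nat \<Rightarrow> bool" where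
  "marking i S near w p e \<longleftrightarrow> greedy i S \<and> w \<in> q ` S \<and>
     off w \<le> p \<and> p \<le> e \<and> e = off (Suc w) \<and>
     (\<forall>v<n. (near v \<noteq> 0 \<longrightarrow> v \<in> nbhd S) \<and> (v \<in> nbhd S \<longrightarrow> near v \<noteq> 0 \<or> v \<in> (!) flat ` {p..<e}))"

definition idle :: "nat \<Rightarrow> nat set \<Rightarrow> (nat \<Rightarrow> nat) \<Rightarrow> nat \<Rightarrow> nat \<Rightarrow> bool" where
  "idle i S near p e \<longleftrightarrow> \<not> p < e \<and> greedy i S \<and> exact near S"

lemma greedy_subset: "greedy i S \<Longrightarrow> S \<subseteq> {..<n}"
  unfolding greedy_def by blast

text \<open>A list read to its end without a selection supplies the hypothesis of
  \<open>greedy_skip\<close>.\<close>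

lemma idle_probing:
  assumes "probing i S near x w p e" "\<not> p < e"
  shows "idle i S near p e"
proof -
  have i: "i < n" "x = q i" "w = q (par i)" and pe: "p = off (Suc x)"
    and S: "greedy (Suc i) S" "exact near S"
    and seen: "\<And>k. off x \<le> k \<Longrightarrow> k < p \<Longrightarrow> flat ! k \<noteq> w \<Longrightarrow> x \<in> nbhd S \<or> flat ! k \<in> nbhd S"
    using assms unfolding probing_def by auto
  have "covers S i \<or> covers S y" if y: "adj_pos i y" "y \<noteq> par i" for y
  proof -
    have "q y \<in> {u. {x, u} \<in> E}" using y(1) i unfolding adj_pos_def by simp
    then obtain k where k: "off x \<le> k" "k < p" "flat ! k = q y"
      unfolding flat_segment[OF q_less[OF i(1)], folded i(2), symmetric] pe by auto
    have yn: "y < n" "par i < n" using y(1) i parent_le[of i] unfolding adj_pos_def by auto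
    then have "q y \<noteq> w" using y(2) i inj by (auto simp: inj_on_def)
    then show ?thesis
      using seen[OF k(1,2)] k(3) covers_iff[OF greedy_subset[OF S(1)]] i yn by auto
  qed
  then have "greedy i S" by (rule greedy_skip[OF S(1)])
  then show ?thesis using S assms(2) unfolding idle_def by blast
qed

text \<open>With no part of the list left, the two implications in \<open>marking\<close> combine to
  \<open>exact\<close>.\<close>

lemma idle_marking:
  assumes "marking i S near w p e" "\<not> p < e"
  shows "idle i S near p e"
proof -
  have empty: "{p..<e} = {}" using assms(2) by simp
  show ?thesis
    using assms unfolding marking_def idle_def exact_def empty image_empty by blast
qed

lemma check_next:
  assumes "idle (Suc i) S near p e" "i < n"
  shows "probing i S near (q i) (q (par i)) (off (q i)) (off (Suc (q i)))"
  using assms off_Suc[OF q_less[OF assms(2)]] unfolding idle_def probing_def by auto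

lemma checked:
  assumes "probing i S near x w p e" "p < e"
  shows "{x, flat ! p} \<in> E" "flat ! p < n" "e \<le> length flat" "x < n"
proof -
  have x: "x < n" using assms q_less unfolding probing_def by blast
  then show "x < n" .
  show edge: "{x, flat ! p} \<in> E" using flat_edge[OF x] assms unfolding probing_def by blast
  show "flat ! p < n" using edge_less[OF edge] by simp
  show "e \<le> length flat" using assms off_le[of "Suc x"] x unfolding probing_def by simp
qed

lemma check_pass:
  assumes c: "probing i S near x w p e" "p < e"
    and "\<not> (near x = 0 \<and> near (flat ! p) = 0 \<and> flat ! p \<noteq> w)"
  shows "probing i S near x w (Suc p) e"
proof -
  have "x \<in> nbhd S \<or> flat ! p \<in> nbhd S" if "flat ! p \<noteq> w"
    using assms that checked[OF c] unfolding probing_def exact_def by blast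
  then show ?thesis using c unfolding probing_def by (auto simp: less_Suc_eq)
qed

text \<open>By \<open>greedy_add\<close> the index drops to \<open>i\<close> at once, so the list
  pointers may be overwritten. Only the neighbours of \<open>w\<close> may still be missing from
  \<open>near\<close>, and \<open>marking\<close> allows for that.\<close>

lemma check_fail:
  assumes c: "probing i S near x w p e" "p < e"
    and y: "near x = 0" "near (flat ! p) = 0" "flat ! p \<noteq> w"
  shows "par i \<notin> S" "par i < n" "w = q (par i)"
    "marking i (insert (par i) S) (near(w := Suc 0)) w (off w) (off (Suc w))"
proof -
  have i: "i < n" "x = q i" and S: "greedy (Suc i) S" "exact near S"
    using c unfolding probing_def by auto
  show w: "w = q (par i)" using c unfolding probing_def by auto
  show par: "par i < n" using parent_le[OF i(1)] i(1) by simp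
  obtain j where j: "flat ! p = q j" "adj_pos i j"
    using adj_posI[OF i(1)] checked(1)[OF c] i(2) by blast
  have jn: "j < n" using j(2) unfolding adj_pos_def by blast
  have "\<not> covers S i" "\<not> covers S j"
    using covers_iff[OF greedy_subset[OF S(1)]] i jn y(1,2) S(2) j(1) checked[OF c]
    unfolding exact_def by auto
  moreover have "j \<noteq> par i" using y(3) j(1) w by blast
  ultimately have add: "par i \<notin> S" "greedy i (insert (par i) S)"
    using greedy_add[OF S(1) j(2)] by blast+
  show "par i \<notin> S" by (rule add)
  have wn: "w < n" using w par q_less by simp
  have seg: "(!) flat ` {off w..<off (Suc w)} = {u. {w, u} \<in> E}"
    by (rule flat_segment[OF wn])
  have "nbhd (insert (par i) S) = insert w (nbhd S \<union> {u. {w, u} \<in> E})"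
    unfolding nbhd_def w by auto
  then show "marking i (insert (par i) S) (near(w := Suc 0)) w (off w) (off (Suc w))"
    using add(2) S(2) off_Suc[OF wn] w unfolding marking_def seg exact_def by auto
qed

lemma marked:
  assumes "marking i S near w p e" "p < e"
  shows "{w, flat ! p} \<in> E" "flat ! p < n" "e \<le> length flat"
proof -
  have w: "w < n" using assms q_less greedy_subset unfolding marking_def by blast
  show edge: "{w, flat ! p} \<in> E" using flat_edge[OF w] assms unfolding marking_def by blast
  show "flat ! p < n" using edge_less[OF edge] by simp
  show "e \<le> length flat" using assms off_le[of "Suc w"] w unfolding marking_def by simp
qed

lemma mark_next:
  assumes m: "marking i S near w p e" "p < e"
  shows "marking i S (near(flat ! p := Suc 0)) w (Suc p) e"
proof -
  have "flat ! p \<in> nbhd S"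
    using marked(1)[OF m] m unfolding marking_def nbhd_def by blast
  moreover have "{p..<e} = insert p {Suc p..<e}" using m(2) by auto
  ultimately show ?thesis using m unfolding marking_def by auto
qed

end

section \<open>The program\<close>

abbreviation var :: "string \<Rightarrow> aexp" where
  "var x \<equiv> Entry x (Const 0)"

abbreviation set_var :: "string \<Rightarrow> aexp \<Rightarrow> com" where
  "set_var x a \<equiv> Assign x (Const 0) a"

text \<open>\<open>v\<close> and \<open>f\<close> are evaluated anew at each assignment;
  \<open>t\<close> is increased last because a root passes \<open>t\<close> as
  \<open>f\<close>.\<close>

definition discover :: "aexp \<Rightarrow> aexp \<Rightarrow> com" where
  "discover v f =
     Seq (Assign ''seen'' v (Const 1))
    (Seq (Assign ''q'' (var ''t'') v)
    (Seq (Assign ''par'' (var ''t'') f)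
         (set_var ''t'' (Plus (var ''t'') (Const 1)))))"

text \<open>Both loops are flat: one iteration does a bounded amount of work, namely one entry of the
  adjacency list that is being scanned (entries \<open>p\<close> to \<open>e\<close>) or the passage to the next list.\<close>

definition search_guard :: bexp where
  "search_guard = Not (And (Not (Less (var ''p'') (var ''e'')))
     (And (Not (Less (var ''h'') (var ''t''))) (Not (Less (var ''r'') (var ''n'')))))"

definition search_step :: com where
  "search_step =
     If (Less (var ''p'') (var ''e''))
       (Seq (If (Equal (Entry ''seen'' (Entry ''adj'' (var ''p''))) (Const 0))
              (discover (Entry ''adj'' (var ''p'')) (Minus (var ''h'') (Const 1))) Skip)
            (set_var ''p'' (Plus (var ''p'') (Const 1))))
       (If (Less (var ''h'') (var ''t''))
         (Seq (set_var ''p'' (Entry ''off'' (Entry ''q'' (var ''h''))))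
         (Seq (set_var ''e'' (Entry ''off'' (Plus (Entry ''q'' (var ''h'')) (Const 1))))
              (set_var ''h'' (Plus (var ''h'') (Const 1)))))
         (Seq (If (Equal (Entry ''seen'' (var ''r'')) (Const 0))
                (discover (var ''r'') (var ''t'')) Skip)
              (set_var ''r'' (Plus (var ''r'') (Const 1)))))"

definition greedy_guard :: bexp where
  "greedy_guard = Not (And (Not (Less (var ''p'') (var ''e''))) (Not (Less (Const 0) (var ''i''))))"

definition greedy_step :: com where
  "greedy_step =
     If (Less (var ''p'') (var ''e''))
       (If (Equal (var ''mark'') (Const 1))
         (Seq (Assign ''near'' (Entry ''adj'' (var ''p'')) (Const 1))
              (set_var ''p'' (Plus (var ''p'') (Const 1))))
         (If (And (Equal (Entry ''near'' (var ''x'')) (Const 0))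
             (And (Equal (Entry ''near'' (Entry ''adj'' (var ''p''))) (Const 0))
                  (Not (Equal (Entry ''adj'' (var ''p'')) (var ''w'')))))
           (Seq (Assign ''out'' (var ''size'') (var ''w''))
           (Seq (set_var ''size'' (Plus (var ''size'') (Const 1)))
           (Seq (Assign ''near'' (var ''w'') (Const 1))
           (Seq (set_var ''mark'' (Const 1))
           (Seq (set_var ''p'' (Entry ''off'' (var ''w'')))
                (set_var ''e'' (Entry ''off'' (Plus (var ''w'') (Const 1)))))))))
           (set_var ''p'' (Plus (var ''p'') (Const 1)))))
       (Seq (set_var ''i'' (Minus (var ''i'') (Const 1)))
       (Seq (set_var ''x'' (Entry ''q'' (var ''i'')))
       (Seq (set_var ''w'' (Entry ''q'' (Entry ''par'' (var ''i''))))
       (Seq (set_var ''mark'' (Const 0))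
       (Seq (set_var ''p'' (Entry ''off'' (var ''x'')))
            (set_var ''e'' (Entry ''off'' (Plus (var ''x'') (Const 1)))))))))"

text \<open>\<open>p\<close> and \<open>e\<close> are not reset between the loops: the search stops
  only with an exhausted list, so the greedy loop starts idle.\<close>

definition ve_program :: com where
  "ve_program =
     Seq (While search_guard search_step)
    (Seq (set_var ''i'' (var ''n''))
         (While greedy_guard greedy_step))"

section \<open>Invariant and potential of the search loop\<close>

context listed_graph
begin

definition holds_input :: "state \<Rightarrow> bool" where
  "holds_input s \<longleftrightarrow> s ''n'' 0 = n \<and> (\<forall>i\<le>n. s ''off'' i = off i) \<and>
     (\<forall>k<length flat. s ''adj'' k = flat ! k)"

text \<open>The potential \<open>k\<close> counts untried roots, vertices not yet removed, unread
  entries of the current list, and the lists of the vertices not yet removed.\<close>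

definition search_inv :: "nat \<Rightarrow> state \<Rightarrow> bool" where
  "search_inv k s \<longleftrightarrow> holds_input s \<and> s ''size'' 0 = 0 \<and> (\<forall>v. s ''near'' v = 0) \<and>
     searching n E adj (s ''q'') (s ''par'') (s ''seen'') (s ''t'' 0) (s ''h'' 0) (s ''r'' 0)
       (s ''p'' 0) (s ''e'' 0) \<and>
     k = (n - s ''r'' 0) + (n - s ''h'' 0) + (s ''e'' 0 - s ''p'' 0) +
       (\<Sum>v \<in> {..<n} - s ''q'' ` {..<s ''h'' 0}. deg v)"

lemma holds_input_init: "holds_input (input_state adj)"
  unfolding holds_input_def input_state_def off_def flat_def by (simp add: length_adj)

lemma searching_init: "searching n E adj q par (\<lambda>_. 0) 0 0 0 0 0"
  by unfold_locales auto

lemma search_inv_init: "search_inv (2 * n + length flat) (input_state adj)"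
  using holds_input_init searching_init sum_deg
  unfolding search_inv_def by (simp add: input_state_def[abs_def])

lemma search_step_inv:
  assumes "search_inv k s" "bval search_guard s" and w: "n \<le> w" "length flat \<le> w" "1 \<le> w"
  shows "safe w search_step s \<and> (\<exists>k' < k. search_inv k' (sem search_step s))"
proof -
  let ?q = "s ''q''" and ?t = "s ''t'' 0" and ?h = "s ''h'' 0" and ?r = "s ''r'' 0"
    and ?p = "s ''p'' 0" and ?e = "s ''e'' 0"
  interpret searching n E adj ?q "s ''par''" "s ''seen''" ?t ?h ?r ?p ?e
    using assms(1) unfolding search_inv_def by blast
  have inp: "s ''n'' 0 = n" "\<And>i. i \<le> n \<Longrightarrow> s ''off'' i = off i"
    "\<And>j. j < length flat \<Longrightarrow> s ''adj'' j = flat ! j" "s ''size'' 0 = 0" "\<And>v. s ''near'' v = 0"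
    using assms(1) unfolding search_inv_def holds_input_def by auto
  have k: "k = (n - ?r) + (n - ?h) + (?e - ?p) + (\<Sum>v \<in> {..<n} - ?q ` {..<?h}. deg v)"
    using assms(1) unfolding search_inv_def by blast
  show ?thesis
  proof (cases "?p < ?e")
    case True
    note scanned = scanned[OF True]
    have y: "s ''adj'' ?p = flat ! ?p" using inp(3) scanned(2) True by simp
    show ?thesis
    proof (cases "s ''seen'' (flat ! ?p) = 0")
      case new: True
      note next_inv = scan_push[OF True new]
      \<comment> \<open>The invariant of the next state bounds the new queue length, which has to
        fit into a word.\<close>
      have "Suc ?t \<le> n" using searching.t_le[OF next_inv] .
      moreover have "(?q(?t := flat ! ?p)) ` {..<?h} = ?q ` {..<?h}"
        using h_le by (intro image_cong) auto
      ultimately show ?thesis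
        using next_inv inp True y new w scanned h_le
        unfolding search_step_def discover_def search_inv_def holds_input_def k by (simp; arith)
    next
      case False
      then show ?thesis
        using scan_seen[OF True False] inp True y w scanned
        unfolding search_step_def discover_def search_inv_def holds_input_def k by simp
    qed
  next
    case p: False
    show ?thesis
    proof (cases "?h < ?t")
      case True
      note q = q_less[OF True]
      have "?q ?h \<notin> ?q ` {..<?h}"
        using inj_on_image_mem_iff[OF inj, of ?h "{..<?h}"] True by auto
      then have "{..<n} - ?q ` {..<?h} = insert (?q ?h) ({..<n} - ?q ` {..<Suc ?h})"
        "?q ?h \<notin> {..<n} - ?q ` {..<Suc ?h}"
        unfolding lessThan_Suc using q by auto
      \<comment> \<open>The degree that leaves the sum returns as the length of the current list;
        the decrease comes from \<open>n - h\<close>.\<close>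
      then have sum: "(\<Sum>v \<in> {..<n} - ?q ` {..<?h}. deg v) =
          deg (?q ?h) + (\<Sum>v \<in> {..<n} - ?q ` {..<Suc ?h}. deg v)"
        by (simp add: sum.insert)
      have "?h < n" using True t_le by simp
      then show ?thesis
        using pop[OF p True] inp p True q w off_le[of "?q ?h"] off_le[of "Suc (?q ?h)"] off_Suc[OF q]
        unfolding search_step_def discover_def search_inv_def holds_input_def k sum by simp
    next
      case h: False
      have r: "?r < n" using assms(2) p h inp(1) unfolding search_guard_def by simp
      show ?thesis
      proof (cases "s ''seen'' ?r = 0")
        case True
        note next_inv = root_push[OF p h r True]
        have "Suc ?t \<le> n" using searching.t_le[OF next_inv] .
        moreover have "(?q(?t := ?r)) ` {..<?h} = ?q ` {..<?h}"
          using h_le by (intro image_cong) auto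
        ultimately show ?thesis
          using next_inv inp True p h w r h_le
          unfolding search_step_def discover_def search_inv_def holds_input_def k by simp
      next
        case False
        then show ?thesis
          using root_seen[OF r False] inp p h w r
          unfolding search_step_def discover_def search_inv_def holds_input_def k by simp
      qed
    qed
  qed
qed

lemma search_finished:
  assumes "search_inv k s" "\<not> bval search_guard s" "block_graph {..<n} E"
  shows "searched n E adj (s ''q'') (s ''par'')"
proof -
  let ?q = "s ''q''" and ?t = "s ''t'' 0" and ?h = "s ''h'' 0" and ?r = "s ''r'' 0"
    and ?p = "s ''p'' 0" and ?e = "s ''e'' 0"
  interpret searching n E adj ?q "s ''par''" "s ''seen''" ?t ?h ?r ?p ?e
    using assms(1) unfolding search_inv_def by blast
  have "s ''n'' 0 = n" using assms(1) unfolding search_inv_def holds_input_def by blast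
  then have fin: "?h = ?t" "?r = n"
    using assms(2) h_le r_le unfolding search_guard_def by auto
  then have range: "?q ` {..<?t} = {..<n}" using below_r q_less by auto
  then have t: "?t = n" using card_image[OF inj] by simp
  show ?thesis
  proof
    show "?q ` {..<n} = {..<n}" "inj_on ?q {..<n}" using range inj t by auto
    show "s ''par'' j \<le> i" if "j < n" "i < j" "{?q i, ?q j} \<in> E" for i j
      using early[of i j] that fin t by simp
  qed (use assms(3) par_le par_edge par_mono t in auto)
qed

end

section \<open>Invariant and potential of the greedy loop\<close>

context searched
begin

text \<open>The two sums in \<open>k\<close> pay for lists still to be probed and for lists of
  unselected vertices that may still be marked. Initially each list is thus paid for twice.\<close>

definition greedy_inv :: "nat \<Rightarrow> state \<Rightarrow> bool" where
  "greedy_inv k s \<longleftrightarrow> holds_input s \<and> s ''q'' = q \<and> s ''par'' = par \<and> s ''i'' 0 \<le> n \<and>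
     (\<exists>S. S \<subseteq> {..<n} \<and> distinct (output_list s) \<and> set (output_list s) = q ` S \<and>
       (idle (s ''i'' 0) S (s ''near'') (s ''p'' 0) (s ''e'' 0) \<or>
        (s ''mark'' 0 \<noteq> 1 \<and> probing (s ''i'' 0) S (s ''near'') (s ''x'' 0) (s ''w'' 0) (s ''p'' 0) (s ''e'' 0)) \<or>
        (s ''mark'' 0 = 1 \<and> marking (s ''i'' 0) S (s ''near'') (s ''w'' 0) (s ''p'' 0) (s ''e'' 0))) \<and>
       k = s ''i'' 0 + (s ''e'' 0 - s ''p'' 0) + (\<Sum>j<s ''i'' 0. deg (q j)) + (\<Sum>j\<in>{..<n} - S. deg (q j)))"

lemma sum_deg_q: "(\<Sum>j<n. deg (q j)) = length flat"
  using sum.reindex[OF inj, of deg] range sum_deg by simp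

lemma greedy_inv_init:
  assumes "holds_input s" "s ''q'' = q" "s ''par'' = par" "s ''size'' 0 = 0" "\<And>v. s ''near'' v = 0"
    "\<not> s ''p'' 0 < s ''e'' 0" "s ''i'' 0 = n"
  shows "greedy_inv (n + 2 * length flat) s"
proof -
  have "idle n {} (s ''near'') (s ''p'' 0) (s ''e'' 0)"
    using assms greedy_empty unfolding idle_def exact_def nbhd_def by simp
  then show ?thesis
    unfolding greedy_inv_def using assms sum_deg_q
    by (intro conjI exI[of _ "{}"]) (auto simp: output_list_def)
qed

lemma idle_end:
  assumes "greedy_inv k s" "\<not> s ''p'' 0 < s ''e'' 0"
  shows "\<exists>S. S \<subseteq> {..<n} \<and> distinct (output_list s) \<and> set (output_list s) = q ` S \<and>
    idle (s ''i'' 0) S (s ''near'') (s ''p'' 0) (s ''e'' 0) \<and>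
    k = s ''i'' 0 + (\<Sum>j<s ''i'' 0. deg (q j)) + (\<Sum>j\<in>{..<n} - S. deg (q j))"
proof -
  obtain S where S: "S \<subseteq> {..<n}" "distinct (output_list s)" "set (output_list s) = q ` S"
    and "idle (s ''i'' 0) S (s ''near'') (s ''p'' 0) (s ''e'' 0) \<or>
      probing (s ''i'' 0) S (s ''near'') (s ''x'' 0) (s ''w'' 0) (s ''p'' 0) (s ''e'' 0) \<or>
      marking (s ''i'' 0) S (s ''near'') (s ''w'' 0) (s ''p'' 0) (s ''e'' 0)"
    and "k = s ''i'' 0 + (s ''e'' 0 - s ''p'' 0) + (\<Sum>j<s ''i'' 0. deg (q j)) +
      (\<Sum>j\<in>{..<n} - S. deg (q j))"
    using assms(1) unfolding greedy_inv_def by blast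
  moreover from this(4) have "idle (s ''i'' 0) S (s ''near'') (s ''p'' 0) (s ''e'' 0)"
    using idle_probing[OF _ assms(2)] idle_marking[OF _ assms(2)] by blast
  ultimately show ?thesis using assms(2) by (intro exI[of _ S]) simp
qed

lemma size_eq_card:
  assumes "S \<subseteq> {..<n}" "distinct (output_list s)" "set (output_list s) = q ` S"
  shows "s ''size'' 0 = card S"
proof -
  have "s ''size'' 0 = card (q ` S)"
    using distinct_card[OF assms(2)] assms(3) by (simp add: output_list_def)
  then show ?thesis using card_image inj_on_subset[OF inj assms(1)] by metis
qed

lemma greedy_step_inv:
  assumes "greedy_inv k s" "bval greedy_guard s" and w: "n \<le> w" "length flat \<le> w" "1 \<le> w"
  shows "safe w greedy_step s \<and> (\<exists>k' < k. greedy_inv k' (sem greedy_step s))"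
proof -
  let ?i = "s ''i'' 0" and ?x = "s ''x'' 0" and ?w = "s ''w'' 0" and ?near = "s ''near''"
    and ?p = "s ''p'' 0" and ?e = "s ''e'' 0"
  have inp: "s ''n'' 0 = n" "\<And>i. i \<le> n \<Longrightarrow> s ''off'' i = off i"
    "\<And>j. j < length flat \<Longrightarrow> s ''adj'' j = flat ! j" "s ''q'' = q" "s ''par'' = par" "?i \<le> n"
    using assms(1) unfolding greedy_inv_def holds_input_def by auto
  show ?thesis
  proof (cases "?p < ?e")
    case p: True
    obtain S where S: "S \<subseteq> {..<n}" "distinct (output_list s)" "set (output_list s) = q ` S"
      and phase: "s ''mark'' 0 \<noteq> 1 \<and> probing ?i S ?near ?x ?w ?p ?e \<or>
        s ''mark'' 0 = 1 \<and> marking ?i S ?near ?w ?p ?e"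
      and k: "k = ?i + (?e - ?p) + (\<Sum>j<?i. deg (q j)) + (\<Sum>j\<in>{..<n} - S. deg (q j))"
      using assms(1) p unfolding greedy_inv_def idle_def by blast
    show ?thesis
    proof (cases "s ''mark'' 0 = 1")
      case True
      then have m: "marking ?i S ?near ?w ?p ?e" using phase by blast
      note marked = marked[OF m p]
      have y: "s ''adj'' ?p = flat ! ?p" using inp(3) marked(3) p by simp
      let ?s = "sem greedy_step s"
      have out: "output_list ?s = output_list s"
        unfolding greedy_step_def output_list_def using p True by simp
      have "greedy_inv (k - 1) ?s"
        unfolding greedy_inv_def out
        using S mark_next[OF m p] inp p y True
        by (intro conjI exI[of _ S]) (auto simp: greedy_step_def holds_input_def k)
      moreover have "k - 1 < k" using p unfolding k by simp
      ultimately show ?thesis using p True w marked by (auto simp: greedy_step_def)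
    next
      case False
      then have c: "probing ?i S ?near ?x ?w ?p ?e" using phase by blast
      note checked = checked[OF c p]
      have y: "s ''adj'' ?p = flat ! ?p" using inp(3) checked(3) p by simp
      let ?s = "sem greedy_step s"
      show ?thesis
      proof (cases "?near ?x = 0 \<and> ?near (flat ! ?p) = 0 \<and> flat ! ?p \<noteq> ?w")
        case True
        then have test: "?near ?x = 0" "?near (flat ! ?p) = 0" "flat ! ?p \<noteq> ?w" by auto
        note fail = check_fail[OF c p test]
        let ?S = "insert (par ?i) S"
        have wn: "?w < n" using fail(2,3) q_less by simp
        have "?w \<notin> q ` S" using fail(1-3) S(1) inj by (auto simp: inj_on_def)
        moreover have out: "output_list ?s = output_list s @ [?w]"
          unfolding greedy_step_def output_list_def using p False test y by simp
        ultimately have out': "distinct (output_list ?s)" "set (output_list ?s) = q ` ?S"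
          using S(2,3) fail(3) by auto
        have S': "?S \<subseteq> {..<n}" using S(1) fail(2) by simp
        have sum: "(\<Sum>j\<in>{..<n} - S. deg (q j)) = deg ?w + (\<Sum>j\<in>{..<n} - ?S. deg (q j))"
          unfolding Diff_insert[of _ _ S]
          using sum.remove[of "{..<n} - S" "par ?i" "\<lambda>j. deg (q j)"] fail(1-3) by simp
        have "card ?S \<le> n" using card_mono[OF _ S'] by simp
        then have size: "Suc (s ''size'' 0) \<le> w"
          using size_eq_card[OF S] fail(1) S(1) finite_subset[OF S(1)] w(1) by simp
        \<comment> \<open>\<open>deg ?w\<close> moves from the last sum to the current list;
          dropping the unread rest of the list of \<open>x\<close>, nonempty by \<open>p\<close>,
          gives the decrease.\<close>
        let ?k = "?i + deg ?w + (\<Sum>j<?i. deg (q j)) + (\<Sum>j\<in>{..<n} - ?S. deg (q j))"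
        have "greedy_inv ?k ?s"
          unfolding greedy_inv_def
          using S' out' fail(4) inp p y False test wn off_Suc[OF wn]
          by (intro conjI exI[of _ ?S]) (auto simp: greedy_step_def holds_input_def)
        moreover have "?k < k" using p unfolding k sum by simp
        moreover have "safe w greedy_step s"
          using p False test y w size wn inp off_le[of ?w] off_le[of "Suc ?w"]
          by (simp add: greedy_step_def)
        ultimately show ?thesis by blast
      next
        case test: False
        have s': "?s = s(''p'' := (s ''p'')(0 := Suc ?p))"
          using p False test y by (auto simp: greedy_step_def)
        have out: "output_list ?s = output_list s" unfolding s' output_list_def by simp
        have "greedy_inv (k - 1) ?s"
          unfolding greedy_inv_def out
          using S check_pass[OF c p test] inp p False
          by (intro conjI exI[of _ S]) (auto simp: s' holds_input_def k)
        moreover have "k - 1 < k" using p unfolding k by simp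
        moreover have "safe w greedy_step s"
          using p False test y w checked(3) by (auto simp: greedy_step_def)
        ultimately show ?thesis by blast
      qed
    qed
  next
    case p: False
    obtain S where S: "S \<subseteq> {..<n}" "distinct (output_list s)" "set (output_list s) = q ` S"
      and idle: "idle ?i S ?near ?p ?e"
      and k: "k = ?i + (\<Sum>j<?i. deg (q j)) + (\<Sum>j\<in>{..<n} - S. deg (q j))"
      using idle_end[OF assms(1) p] by blast
    have "0 < ?i" using assms(2) p unfolding greedy_guard_def by simp
    then obtain i where i: "?i = Suc i" using gr0_conv_Suc by blast
    then have i_n: "i < n" using inp(6) by simp
    note q = q_less[OF i_n]
    have par: "q (par i) < n" using q_less parent_le[OF i_n] i_n by simp
    let ?s = "sem greedy_step s"
    have out: "output_list ?s = output_list s"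
      unfolding greedy_step_def output_list_def using p by simp
    \<comment> \<open>Here \<open>deg (q i)\<close> moves from the first sum to the current list,
      and the counter gives the decrease.\<close>
    let ?k = "i + deg (q i) + (\<Sum>j<i. deg (q j)) + (\<Sum>j\<in>{..<n} - S. deg (q j))"
    have "greedy_inv ?k ?s"
      unfolding greedy_inv_def out
      using S check_next[OF idle[unfolded i] i_n] inp p i i_n q off_Suc[OF q]
      by (intro conjI exI[of _ S]) (auto simp: greedy_step_def holds_input_def)
    moreover have "?k < k" unfolding k i by simp
    moreover have "safe w greedy_step s"
      using p i i_n q par inp w off_le[of "q i"] off_le[of "Suc (q i)"] by (simp add: greedy_step_def)
    ultimately show ?thesis by blast
  qed
qed

lemma greedy_finished:
  assumes "greedy_inv k s" "\<not> bval greedy_guard s"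
  shows "distinct (output_list s)" "min_ve_dominating_set {..<n} E (set (output_list s))"
proof -
  have p: "\<not> s ''p'' 0 < s ''e'' 0" and i: "s ''i'' 0 = 0"
    using assms(2) unfolding greedy_guard_def by auto
  show "distinct (output_list s)" "min_ve_dominating_set {..<n} E (set (output_list s))"
    using idle_end[OF assms(1) p] greedy_min_ve_dominating_set unfolding i idle_def by auto
qed

end

section \<open>Total running time\<close>

lemma ve_program_correct:
  assumes "block_graph {..<n} E" "adjacency_lists n E adj" "n \<le> w" "length (concat adj) \<le> w" "1 \<le> w"
  shows "\<exists>t s. exec w ve_program (input_state adj) t s \<and>
    t \<le> (bcost search_guard + cost search_step + bcost greedy_guard + cost greedy_step + 10) *
      (3 * n + 3 * length (concat adj) + 2) \<and>
    distinct (output_list s) \<and> min_ve_dominating_set {..<n} E (set (output_list s))"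
proof -
  interpret listed_graph n E adj
    using assms(1,2) by unfold_locales (simp_all add: block_graph_def)
  have w: "n \<le> w" "length flat \<le> w" "1 \<le> w" using assms by (auto simp: flat_def)
  obtain t1 s1 k1 where t1: "exec w (While search_guard search_step) (input_state adj) t1 s1"
    "t1 \<le> (bcost search_guard + cost search_step + 1) * (2 * n + length flat + 1)"
    and s1: "search_inv k1 s1" "\<not> bval search_guard s1"
    using exec_While[of search_inv search_guard w search_step, OF search_step_inv[OF _ _ w] search_inv_init]
    by blast
  interpret searched n E adj "s1 ''q''" "s1 ''par''" by (rule search_finished[OF s1 assms(1)])
  let ?init = "set_var ''i'' (var ''n'')"
  have n: "s1 ''n'' 0 = n" using s1(1) unfolding search_inv_def holds_input_def by blast
  then have "safe w ?init s1" using w by simp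
  then obtain t2 where t2: "t2 \<le> cost ?init" "exec w ?init s1 t2 (sem ?init s1)"
    using exec_sem by blast
  have "greedy_inv (n + 2 * length flat) (sem ?init s1)"
    using s1 n unfolding search_inv_def search_guard_def
    by (intro greedy_inv_init) (auto simp: holds_input_def)
  then obtain t3 s3 k3 where t3: "exec w (While greedy_guard greedy_step) (sem ?init s1) t3 s3"
    "t3 \<le> (bcost greedy_guard + cost greedy_step + 1) * (n + 2 * length flat + 1)"
    and s3: "greedy_inv k3 s3" "\<not> bval greedy_guard s3"
    using exec_While[of greedy_inv greedy_guard w greedy_step, OF greedy_step_inv[OF _ _ w]]
    by blast
  have "exec w ve_program (input_state adj) (t1 + (t2 + t3)) s3"
    unfolding ve_program_def using exec.Seq t1(1) t2(2) t3(1) by blast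
  \<comment> \<open>The second factor adds up the iteration bounds of both loops; the 10 generously
    absorbs their overheads and the assignment to \<open>i\<close>.\<close>
  moreover have "t1 + (t2 + t3) \<le>
    (bcost search_guard + cost search_step + bcost greedy_guard + cost greedy_step + 10) *
      (3 * n + 3 * length (concat adj) + 2)"
    using t1(2) t2(1) t3(2) unfolding flat_def by (simp add: algebra_simps)
  ultimately show ?thesis using greedy_finished[OF s3] by blast
qed

theorem theorem1:
  "\<exists>(P :: com) (c :: nat) (k :: nat).
     \<forall>(n :: nat) (E :: nat set set) (adj :: nat list list).
       block_graph {..<n} E \<longrightarrow> adjacency_lists n E adj \<longrightarrow>
       (\<exists>t s. exec ((n + card E + 2) ^ k) P (input_state adj) t s \<and>
              t \<le> c * (n + card E + 1) \<and>
              distinct (output_list s) \<and>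
              min_ve_dominating_set {..<n} E (set (output_list s)) \<and>
              length (output_list s) = gamma_ve {..<n} E)"
proof -
  define C where "C = bcost search_guard + cost search_step + bcost greedy_guard + cost greedy_step + 10"
  have "\<exists>t s. exec ((n + card E + 2) ^ 2) ve_program (input_state adj) t s \<and>
      t \<le> (6 * C) * (n + card E + 1) \<and> distinct (output_list s) \<and>
      min_ve_dominating_set {..<n} E (set (output_list s)) \<and>
      length (output_list s) = gamma_ve {..<n} E"
    if graph: "block_graph {..<n} E" "adjacency_lists n E adj" for n E adj
  proof -
    interpret listed_graph n E adj
      using graph by unfold_locales (simp_all add: block_graph_def)
    have len: "length (concat adj) \<le> 2 * card E" using length_flat_le by (simp add: flat_def)
    define w where "w = (n + card E + 2) ^ 2"
    \<comment> \<open>List positions reach up to \<open>2 * card E\<close>. Squaring a number that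
      is at least 2 also at least doubles it, hence the exponent 2 and the summand 2.\<close>
    have "2 * (n + card E + 2) \<le> w" by (simp add: power2_eq_square w_def)
    then have "n \<le> w" "length (concat adj) \<le> w" "1 \<le> w" using len by auto
    from ve_program_correct[OF graph this, folded C_def, unfolded w_def]
    obtain t s where ts: "exec ((n + card E + 2) ^ 2) ve_program (input_state adj) t s"
      "t \<le> C * (3 * n + 3 * length (concat adj) + 2)"
      "distinct (output_list s)" "min_ve_dominating_set {..<n} E (set (output_list s))"
      by blast
    \<comment> \<open>The factor 6 is 3 per list entry times two entries per edge.\<close>
    have "C * (3 * n + 3 * length (concat adj) + 2) \<le> C * (6 * (n + card E + 1))"
      using len by (intro mult_left_mono) auto
    then have "t \<le> (6 * C) * (n + card E + 1)" using ts(2) by (simp add: algebra_simps)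
    moreover have "length (output_list s) = gamma_ve {..<n} E"
      using gamma_ve_eq_card[OF ts(4)] distinct_card[OF ts(3)] by simp
    ultimately show ?thesis using ts by blast
  qed
  then show ?thesis by blast
qed

end
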